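(* Let $s\ge 2$, $p\ge 2$ be integers, $n=2s+2p$, and let $Z$ be a multiset of $n$ real numbers consisting of $c_1=\frac{3s+p+\sqrt{(s+p)^2+4sp}}{2}$ (once), $d_1=2s+p$ (with multiplicity $2(s-1)$), $c_2=s+p$ (once), $c_3=\frac{3s+p-\sqrt{(s+p)^2+4sp}}{2}$ (once), $c_4=0$ (once), together with two multisets $X$ and $Y$, each with exactly $p-1$ elements, satisfying the following. Writing the distinct values of $X$ as $x_1,\dots,x_j$ with multiplicities $exp_1,\dots,exp_j$: each $x_i$ satisfies $s\le x_i\le s+p$; if $x_i>s$ then $x_i\ge s+2$ and $exp_i=k_i(x_i-s-1)$ for some positive integer $k_i$, and one sets $n_i=k_i(x_i-s)$; if $x_i=s$ one sets $n_i=0$; and $\sum_{i=1}^{j}n_i\le p$. The same conditions hold for the distinct values $y_1,\dots,y_\ell$ of $Y$ with multiplicities $exp'_i=k'_i(y_i-s-1)$, $n'_i=k'_i(y_i-s)$ for $y_i>s$, $n'_i=0$ for $y_i=s$, and $\sum_{i=1}^{\ell}n'_i\le p$. Then there exists a graph $G\in\mathcal{G}(s,p)$ whose Laplacian spectrum (multiset of eigenvalues of $L(G)$) is exactly $Z$.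
   Context: All graphs are finite, simple and connected. The Laplacian matrix of $G$ is $L(G)=\mathcal{D}(G)-A(G)$ (degree matrix minus adjacency matrix). A vertex is simplicial if its neighbourhood is a clique. A minimal vertex separator is a set $S$ that, for some non-adjacent vertices $u,v$, separates $u$ and $v$ into different components of $G-S$ and is inclusion-minimal with this property. A graph is strictly chordal if it is obtained from a block graph (connected graph all of whose blocks are cliques) by adding zero or more true twins ($N[u]=N[v]$) to each vertex; a strictly interval graph is one that is both strictly chordal and an interval graph. For integers $s,p\ge 2$, $\mathcal{G}(s,p)$ is the set of $SI$-core graphs: strictly interval graphs $G$ with exactly two minimal vertex separators $S_1,S_2$, $|S_1|=|S_2|=s$, $S_1\cup S_2$ a maximal clique of $G$, and each $S_i$ having exactly $p$ simplicial vertices adjacent to it. Explicitly, $V(G)=S_1\cup S_2\cup P_1\cup P_2$ (disjoint), $|P_i|=p$, every vertex of $P_i$ is adjacent to all of $S_i$ and to no vertex of $S_{3-i}\cup P_{3-i}$, and $G[P_i]$ is a disjoint union of complete graphs.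
   Formalization: The elements of X and Y are additionally assumed to be integers; without this the claim fails (s=2, p=5, X={9/2,9/2,9/2,2}, Y={7,7,7,7}), since a non-integral rational cannot be a Laplacian eigenvalue. *)

theory Defs
  imports
    "Graph_Theory.Graph_Theory"
    "Jordan_Normal_Form.Char_Poly"
begin

text \<open>
  A finite simple graph is a digraph \<open>G\<close> satisfying \<^locale>\<open>pair_graph\<close> (finite, symmetric,
  loop-free, at most one arc per ordered pair): \<open>u\<close> and \<open>v\<close> are adjacent iff
  \<open>(u, v) \<in> parcs G\<close>.
\<close>

definition nbhd :: "'a pair_pre_digraph \<Rightarrow> 'a \<Rightarrow> 'a set" where
  "nbhd G v = {u. (v, u) \<in> parcs G}"

definition is_clique :: "'a pair_pre_digraph \<Rightarrow> 'a set \<Rightarrow> bool" where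
  "is_clique G K \<longleftrightarrow> K \<subseteq> pverts G \<and> (\<forall>u\<in>K. \<forall>v\<in>K. u \<noteq> v \<longrightarrow> (u, v) \<in> parcs G)"

definition maximal_clique :: "'a pair_pre_digraph \<Rightarrow> 'a set \<Rightarrow> bool" where
  "maximal_clique G K \<longleftrightarrow> is_clique G K \<and> (\<forall>K'. is_clique G K' \<longrightarrow> \<not> K \<subset> K')"

definition simplicial :: "'a pair_pre_digraph \<Rightarrow> 'a \<Rightarrow> bool" where
  "simplicial G v \<longleftrightarrow> v \<in> pverts G \<and> is_clique G (nbhd G v)"

definition separates :: "'a pair_pre_digraph \<Rightarrow> 'a set \<Rightarrow> 'a \<Rightarrow> 'a \<Rightarrow> bool" where
  "separates G S u v \<longleftrightarrow> S \<subseteq> pverts G - {u, v} \<and>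
     \<not> u \<rightarrow>\<^sup>*\<^bsub>with_proj G \<restriction> (pverts G - S)\<^esub> v"

definition minimal_vertex_separator :: "'a pair_pre_digraph \<Rightarrow> 'a set \<Rightarrow> bool" where
  "minimal_vertex_separator G S \<longleftrightarrow>
     (\<exists>u\<in>pverts G. \<exists>v\<in>pverts G. u \<noteq> v \<and> (u, v) \<notin> parcs G \<and>
        separates G S u v \<and> (\<forall>S'. S' \<subset> S \<longrightarrow> \<not> separates G S' u v))"

text \<open>A cut vertex is one whose removal disconnects two vertices of the same component.\<close>

definition cut_vertex :: "('a, 'b) pre_digraph \<Rightarrow> 'a \<Rightarrow> bool" where
  "cut_vertex H v \<longleftrightarrow> v \<in> verts H \<and>
     (\<exists>u\<in>verts H - {v}. \<exists>w\<in>verts H - {v}. u \<rightarrow>\<^sup>*\<^bsub>H\<^esub> w \<and> \<not> u \<rightarrow>\<^sup>*\<^bsub>pre_digraph.del_vert H v\<^esub> w)"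

definition nonseparable :: "('a, 'b) pre_digraph \<Rightarrow> bool" where
  "nonseparable H \<longleftrightarrow> connected H \<and> (\<forall>v. \<not> cut_vertex H v)"

text \<open>
  A block (maximal connected subgraph without a cut vertex of its own) is always an induced
  subgraph, so it is represented by its vertex set.
\<close>

definition is_block :: "'a pair_pre_digraph \<Rightarrow> 'a set \<Rightarrow> bool" where
  "is_block G B \<longleftrightarrow> B \<subseteq> pverts G \<and> nonseparable (with_proj G \<restriction> B) \<and>
     (\<forall>B'. B \<subset> B' \<and> B' \<subseteq> pverts G \<longrightarrow> \<not> nonseparable (with_proj G \<restriction> B'))"

definition block_graph :: "'a pair_pre_digraph \<Rightarrow> bool" where
  "block_graph G \<longleftrightarrow> pair_graph G \<and> connected (with_proj G) \<and>
     (\<forall>B. is_block G B \<longrightarrow> is_clique G B)"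

text \<open>\<open>add_true_twin G v v'\<close> adds a new vertex \<open>v'\<close> with \<open>N[v'] = N[v]\<close>.\<close>

definition add_true_twin :: "'a pair_pre_digraph \<Rightarrow> 'a \<Rightarrow> 'a \<Rightarrow> 'a pair_pre_digraph" where
  "add_true_twin G v v' =
     \<lparr> pverts = insert v' (pverts G),
       parcs = parcs G \<union> {v'} \<times> insert v (nbhd G v) \<union> insert v (nbhd G v) \<times> {v'} \<rparr>"

inductive strictly_chordal :: "'a pair_pre_digraph \<Rightarrow> bool" where
  block: "block_graph G \<Longrightarrow> strictly_chordal G"
| twin: "strictly_chordal G \<Longrightarrow> v \<in> pverts G \<Longrightarrow> v' \<notin> pverts G \<Longrightarrow>
    strictly_chordal (add_true_twin G v v')"

definition interval_graph :: "'a pair_pre_digraph \<Rightarrow> bool" where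
  "interval_graph G \<longleftrightarrow> pair_graph G \<and>
     (\<exists>l r :: 'a \<Rightarrow> real. (\<forall>v\<in>pverts G. l v \<le> r v) \<and>
        (\<forall>u\<in>pverts G. \<forall>v\<in>pverts G. u \<noteq> v \<longrightarrow>
           ((u, v) \<in> parcs G \<longleftrightarrow> {l u..r u} \<inter> {l v..r v} \<noteq> {})))"

definition strictly_interval :: "'a pair_pre_digraph \<Rightarrow> bool" where
  "strictly_interval G \<longleftrightarrow> strictly_chordal G \<and> interval_graph G"

definition adjacent_simplicial :: "'a pair_pre_digraph \<Rightarrow> 'a set \<Rightarrow> 'a set" where
  "adjacent_simplicial G S = {v \<in> pverts G. simplicial G v \<and> S \<subseteq> nbhd G v}"

definition SI_core :: "nat \<Rightarrow> nat \<Rightarrow> 'a pair_pre_digraph set" where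
  "SI_core s p = {G. strictly_interval G \<and>
     (\<exists>S1 S2. S1 \<noteq> S2 \<and> {S. minimal_vertex_separator G S} = {S1, S2} \<and>
        card S1 = s \<and> card S2 = s \<and> maximal_clique G (S1 \<union> S2) \<and>
        card (adjacent_simplicial G S1) = p \<and> card (adjacent_simplicial G S2) = p)}"

text \<open>
  Rows and columns of the matrices follow the increasing enumeration of the vertices; the
  spectrum does not depend on this choice.
\<close>

definition vertex_list :: "'a::linorder pair_pre_digraph \<Rightarrow> 'a list" where
  "vertex_list G = sorted_list_of_set (pverts G)"

definition adjacency_matrix :: "'a::linorder pair_pre_digraph \<Rightarrow> real mat" where
  "adjacency_matrix G = mat (card (pverts G)) (card (pverts G))
     (\<lambda>(i, j). if (vertex_list G ! i, vertex_list G ! j) \<in> parcs G then 1 else 0)"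

definition degree_matrix :: "'a::linorder pair_pre_digraph \<Rightarrow> real mat" where
  "degree_matrix G = mat (card (pverts G)) (card (pverts G))
     (\<lambda>(i, j). if i = j then real (card (nbhd G (vertex_list G ! i))) else 0)"

definition laplacian_matrix :: "'a::linorder pair_pre_digraph \<Rightarrow> real mat" where
  "laplacian_matrix G = degree_matrix G - adjacency_matrix G"

text \<open>
  The multiset of real eigenvalues; the matrix is real symmetric for a graph, so these are all
  of its eigenvalues.
\<close>

definition laplacian_spectrum :: "'a::linorder pair_pre_digraph \<Rightarrow> real multiset" where
  "laplacian_spectrum G = proots (char_poly (laplacian_matrix G))"

text \<open>
  The condition on the multiset \<open>X\<close>: \<open>count X x\<close> is the multiplicity of the value \<open>x\<close>, and
  \<open>k x\<close> is the positive integer attached to a value \<open>x > s\<close>.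
\<close>

definition spectral_part :: "nat \<Rightarrow> nat \<Rightarrow> real multiset \<Rightarrow> bool" where
  "spectral_part s p X \<longleftrightarrow>
     size X = p - 1 \<and>
     (\<forall>x\<in>#X. real s \<le> x \<and> x \<le> real s + real p) \<and>
     (\<exists>k :: real \<Rightarrow> nat.
        (\<forall>x\<in>#X. x > real s \<longrightarrow>
           x \<ge> real s + 2 \<and> k x > 0 \<and> real (count X x) = real (k x) * (x - real s - 1)) \<and>
        (\<Sum>x\<in>set_mset X. if x = real s then 0 else real (k x) * (x - real s)) \<le> real p)"

end

theory Submission
  imports Defs
begin

text \<open>
  The data attached to \<open>X\<close> describe a partition of \<open>p\<close> into clique sizes: a value \<open>x > s\<close> with
  parameter \<open>k\<close> stands for \<open>k\<close> cliques of size \<open>x - s\<close>, and the remaining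
  \<open>p - (\<Sum> n\<^sub>i)\<close> vertices are isolated. The graph \<open>G\<close> has two cores of \<open>s\<close>
  vertices, joined completely, and the cliques prescribed by \<open>X\<close> and \<open>Y\<close> hang from the first
  and the second core. It arises from a double star by adding true twins, so it is strictly
  chordal. Its Laplacian has an orthogonal basis of eigenfunctions: functions of sum zero on one
  class of true twins (eigenvalues \<open>2s + p\<close> on a core, \<open>s + m\<close> on a clique of size \<open>m\<close>), functions
  of sum zero that are constant on the cliques of one side (eigenvalue \<open>s\<close>), and four functions
  that are constant on the cores and on the two sets of leaves, two of them symmetric (eigenvalues
  \<open>0\<close> and \<open>s + p\<close>) and two antisymmetric (the roots of \<open>t\<^sup>2 - (3s + p) t + 2s\<^sup>2\<close>).
\<close>

section \<open>Spectra from orthogonal eigenfunctions\<close>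

text \<open>The Laplacian as an operator on vertex functions, so that eigenfunctions can be checked
  without enumerating the vertices.\<close>

definition laplacian :: "'a pair_pre_digraph \<Rightarrow> ('a \<Rightarrow> real) \<Rightarrow> 'a \<Rightarrow> real" where
  "laplacian G f v = (\<Sum>u\<in>nbhd G v. f v - f u)"

text \<open>Orthogonality is required between list positions; over a finite \<open>V\<close> no
  function can then occur twice, and the length counts linearly independent functions.\<close>

definition orthogonal_list :: "'a set \<Rightarrow> ('a \<Rightarrow> real) list \<Rightarrow> bool" where
  "orthogonal_list V fs \<longleftrightarrow> (\<forall>f\<in>set fs. \<exists>v\<in>V. f v \<noteq> 0) \<and>
     sorted_wrt (\<lambda>f g. (\<Sum>v\<in>V. f v * g v) = 0) fs"

lemma orthogonal_list_append:
  "orthogonal_list V (fs @ gs) \<longleftrightarrow> orthogonal_list V fs \<and> orthogonal_list V gs \<and>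
     (\<forall>f\<in>set fs. \<forall>g\<in>set gs. (\<Sum>v\<in>V. f v * g v) = 0)"
  by (auto simp: orthogonal_list_def sorted_wrt_append)

lemma orthogonal_list_nth:
  assumes "orthogonal_list V fs" "i < length fs" "j < length fs" "i \<noteq> j"
  shows "(\<Sum>v\<in>V. (fs ! i) v * (fs ! j) v) = 0"
proof (cases "i < j")
  case True
  with assms show ?thesis
    by (auto simp: orthogonal_list_def sorted_wrt_iff_nth_less)
next
  case False
  with assms have "(\<Sum>v\<in>V. (fs ! j) v * (fs ! i) v) = 0"
    by (auto simp: orthogonal_list_def sorted_wrt_iff_nth_less)
  then show ?thesis by (simp add: mult.commute)
qed

text \<open>The sorted enumeration is a bijection from indices to vertices, which turns a row of the
  matrix into a sum over a neighbourhood.\<close>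

lemma laplacian_matrix_mult_fun:
  fixes G :: "'a::linorder pair_pre_digraph"
  assumes G: "pair_graph G" and i: "i < card (pverts G)"
  shows "(\<Sum>j<card (pverts G). laplacian_matrix G $$ (i, j) * f (vertex_list G ! j)) =
    laplacian G f (vertex_list G ! i)"
proof -
  interpret pair_graph G by (rule G)
  let ?n = "card (pverts G)" and ?v = "\<lambda>i. vertex_list G ! i"
  have fin: "finite (pverts G)" by (rule pair_finite_verts)
  have bij: "bij_betw ?v {..<?n} (pverts G)"
    using fin by (intro bij_betw_nth) (auto simp: vertex_list_def)
  have sub: "nbhd G (?v i) \<subseteq> pverts G" by (auto simp: nbhd_def dest: in_arcsD2)
  have "(\<Sum>j<?n. laplacian_matrix G $$ (i, j) * f (?v j)) =
    (\<Sum>j<?n. (if i = j then real (card (nbhd G (?v i))) * f (?v i) else 0)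
       - (if ?v j \<in> nbhd G (?v i) then f (?v j) else 0))"
    using i by (intro sum.cong)
      (auto simp: laplacian_matrix_def degree_matrix_def adjacency_matrix_def nbhd_def
        left_diff_distrib)
  also have "\<dots> = real (card (nbhd G (?v i))) * f (?v i)
      - (\<Sum>j<?n. if ?v j \<in> nbhd G (?v i) then f (?v j) else 0)"
    using i by (simp add: sum_subtractf)
  also have "(\<Sum>j<?n. if ?v j \<in> nbhd G (?v i) then f (?v j) else 0) =
      (\<Sum>u\<in>pverts G. if u \<in> nbhd G (?v i) then f u else 0)"
    by (rule sum.reindex_bij_betw[OF bij])
  also have "\<dots> = (\<Sum>u\<in>nbhd G (?v i). f u)"
    using fin sub by (simp add: sum.inter_restrict[symmetric] Int_absorb1)
  finally show ?thesis by (simp add: laplacian_def sum_subtractf)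
qed

lemma proots_prod_list_linear:
  "proots (\<Prod>a\<leftarrow>xs. [:- a, 1:]) = mset (xs :: 'a::idom list)"
proof (induction xs)
  case (Cons x xs)
  have "(\<Prod>a\<leftarrow>xs. [:- a, 1:]) \<noteq> 0" by (auto simp: prod_list_zero_iff)
  then have "proots ([:- x, 1:] * (\<Prod>a\<leftarrow>xs. [:- a, 1:])) = {#x#} + mset xs"
    by (subst proots_mult) (simp_all add: Cons del: mult_pCons_left)
  then show ?case by simp
qed simp

text \<open>The eigenfunctions are the columns of \<open>P\<close>. Orthogonality makes the
  normalised transpose \<open>Q\<close> its inverse, so the Laplacian matrix is similar to the
  diagonal matrix \<open>D\<close> of the listed values. As there are as many functions as vertices,
  the multiplicities come out right as well.\<close>

lemma laplacian_spectrum_eqI: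
  fixes G :: "'a::linorder pair_pre_digraph" and es :: "(real \<times> ('a \<Rightarrow> real)) list"
  assumes G: "pair_graph G" and len: "length es = card (pverts G)"
    and eig: "\<And>l f v. (l, f) \<in> set es \<Longrightarrow> v \<in> pverts G \<Longrightarrow> laplacian G f v = l * f v"
    and orth: "orthogonal_list (pverts G) (map snd es)"
  shows "laplacian_spectrum G = mset (map fst es)"
proof -
  interpret pair_graph G by (rule G)
  define n where "n = card (pverts G)"
  let ?v = "\<lambda>i. vertex_list G ! i"
  let ?f = "\<lambda>i. snd (es ! i)"
  define L where "L = laplacian_matrix G"
  define P where "P = mat n n (\<lambda>(i, j). ?f j (?v i))"
  define D where "D = mat n n (\<lambda>(i, j). if i = j then fst (es ! j) else 0)"
  \<comment> \<open>Squared norms; dividing by them makes the rows of \<open>Q\<close> dual to the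
    columns of \<open>P\<close>.\<close>
  define q where "q i = (\<Sum>v\<in>pverts G. ?f i v * ?f i v)" for i
  define Q where "Q = mat n n (\<lambda>(i, j). ?f i (?v j) / q i)"
  have bij: "bij_betw ?v {..<n} (pverts G)"
    using pair_finite_verts by (intro bij_betw_nth) (auto simp: vertex_list_def n_def)
  have v: "?v i \<in> pverts G" if "i < n" for i using bij that by (auto simp: bij_betw_def)
  have nz: "\<exists>v\<in>pverts G. ?f i v \<noteq> 0" if "i < n" for i
    using orth that len by (auto simp: orthogonal_list_def n_def)
  have q: "q i \<noteq> 0" if "i < n" for i
    using nz[OF that] pair_finite_verts unfolding q_def
    by (subst sum_nonneg_eq_0_iff) auto
  have carr: "L \<in> carrier_mat n n" "P \<in> carrier_mat n n" "D \<in> carrier_mat n n"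
    "Q \<in> carrier_mat n n"
    by (auto simp: L_def P_def D_def Q_def laplacian_matrix_def degree_matrix_def
        adjacency_matrix_def n_def)
  have QP: "Q * P = 1\<^sub>m n"
  proof (rule eq_matI)
    fix i j assume "i < dim_row (1\<^sub>m n :: real mat)" "j < dim_col (1\<^sub>m n :: real mat)"
    then have ij: "i < n" "j < n" by auto
    have "(Q * P) $$ (i, j) = (\<Sum>k<n. ?f i (?v k) * ?f j (?v k)) / q i"
      using ij carr by (simp add: scalar_prod_def P_def Q_def atLeast0LessThan sum_divide_distrib)
    also have "(\<Sum>k<n. ?f i (?v k) * ?f j (?v k)) = (\<Sum>v\<in>pverts G. ?f i v * ?f j v)"
      by (rule sum.reindex_bij_betw[OF bij])
    also have "\<dots> / q i = (if i = j then 1 else 0)"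
      using orthogonal_list_nth[OF orth, of i j] ij len q[of i] by (auto simp: q_def n_def)
    finally show "(Q * P) $$ (i, j) = 1\<^sub>m n $$ (i, j)" using ij by simp
  qed (use carr in auto)
  have PQ: "P * Q = 1\<^sub>m n"
    by (rule mat_mult_left_right_inverse[OF carr(4,2) QP])
  have LP: "L * P = P * D"
  proof (rule eq_matI)
    fix i j assume "i < dim_row (P * D)" "j < dim_col (P * D)"
    then have ij: "i < n" "j < n" using carr by auto
    have mem: "(fst (es ! j), ?f j) \<in> set es" using ij len by (auto simp: n_def)
    have "(L * P) $$ (i, j) = (\<Sum>k<n. L $$ (i, k) * ?f j (?v k))"
      using ij carr by (simp add: scalar_prod_def P_def atLeast0LessThan)
    also have "\<dots> = fst (es ! j) * ?f j (?v i)"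
      using laplacian_matrix_mult_fun[OF G, of i "?f j"] eig[OF mem v[OF ij(1)]] ij
      by (simp add: L_def n_def)
    also have "\<dots> = (\<Sum>k<n. P $$ (i, k) * D $$ (k, j))"
      using ij by (simp add: P_def D_def if_distrib[of "\<lambda>x. _ * x"] mult.commute cong: if_cong)
    also have "\<dots> = (P * D) $$ (i, j)"
      using ij carr by (simp add: scalar_prod_def atLeast0LessThan)
    finally show "(L * P) $$ (i, j) = (P * D) $$ (i, j)" .
  qed (use carr in auto)
  have "L = L * (P * Q)" using carr PQ by simp
  also have "\<dots> = P * D * Q" using carr LP by (simp flip: assoc_mult_mat[of L n n P n Q n])
  finally have "similar_mat L D"
    by (intro similar_matI[of L D P Q n] PQ QP) (use carr in auto)
  then have "char_poly L = char_poly D" by (rule char_poly_similar)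
  also have "\<dots> = (\<Prod>a\<leftarrow>diag_mat D. [:- a, 1:])"
    by (rule char_poly_upper_triangular[OF carr(3)]) (auto simp: D_def)
  also have "diag_mat D = map fst es"
    using len by (intro nth_equalityI) (auto simp: diag_mat_def D_def n_def)
  finally show ?thesis
    unfolding laplacian_spectrum_def L_def[symmetric] by (simp only: proots_prod_list_linear)
qed

section \<open>Contrasts\<close>

text \<open>The sum runs over \<open>V\<close> so that it matches the inner products; since
  \<open>f\<close> vanishes off \<open>A\<close>, for \<open>A\<close> inside \<open>V\<close> it is
  the sum over \<open>A\<close>.\<close>

definition contrast_on :: "'a set \<Rightarrow> 'a set \<Rightarrow> ('a \<Rightarrow> real) \<Rightarrow> bool" where
  "contrast_on V A f \<longleftrightarrow> (\<forall>v. v \<notin> A \<longrightarrow> f v = 0) \<and> (\<Sum>v\<in>V. f v) = 0"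

definition const_on :: "'a set \<Rightarrow> ('a \<Rightarrow> 'b) \<Rightarrow> bool" where
  "const_on A f \<longleftrightarrow> (\<forall>u\<in>A. \<forall>v\<in>A. f u = f v)"

text \<open>On \<open>A\<close> the factor \<open>g\<close> is a constant and can be pulled out, and
  off \<open>A\<close> the product vanishes; what remains is a multiple of the sum of
  \<open>f\<close>.\<close>

lemma contrast_const_orthogonal:
  assumes "contrast_on V A f" "const_on A g"
  shows "(\<Sum>v\<in>V. f v * g v) = 0"
proof (cases "A = {}")
  case True
  with assms(1) show ?thesis by (simp add: contrast_on_def)
next
  case False
  then obtain a where a: "a \<in> A" by auto
  have "f v * g v = f v * g a" for v
  proof (cases "v \<in> A")
    case True
    with assms(2) a have "g v = g a" unfolding const_on_def by blast
    then show ?thesis by simp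
  qed (use assms(1) in \<open>simp add: contrast_on_def\<close>)
  then have "(\<Sum>v\<in>V. f v * g v) = (\<Sum>v\<in>V. f v) * g a"
    by (simp only: sum_distrib_right)
  with assms(1) show ?thesis by (simp add: contrast_on_def)
qed

text \<open>Helmert contrasts: each function compares one set with the union of the sets after it.\<close>

lemma helmert_contrasts:
  assumes "finite V" "\<forall>A\<in>set As. A \<subseteq> V \<and> A \<noteq> {}" "sorted_wrt disjnt As"
  shows "\<exists>fs. length fs = length As - 1 \<and> orthogonal_list V fs \<and>
    (\<forall>f\<in>set fs. contrast_on V (\<Union>(set As)) f \<and> (\<forall>A\<in>set As. const_on A f))"
  using assms(2,3)
proof (induction As)
  case Nil
  then show ?case by (auto simp: orthogonal_list_def)
next
  case (Cons A As)
  then have "\<exists>fs. length fs = length As - 1 \<and> orthogonal_list V fs \<and>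
      (\<forall>f\<in>set fs. contrast_on V (\<Union>(set As)) f \<and> (\<forall>A\<in>set As. const_on A f))" by simp
  then obtain fs where fs: "length fs = length As - 1" "orthogonal_list V fs"
    "\<And>f. f \<in> set fs \<Longrightarrow> contrast_on V (\<Union>(set As)) f"
    "\<And>f B. f \<in> set fs \<Longrightarrow> B \<in> set As \<Longrightarrow> const_on B f" by blast
  show ?case
  proof (cases "As = []")
    case True
    then show ?thesis by (auto simp: orthogonal_list_def)
  next
    case False
    define U where "U = \<Union>(set As)"
    have fin: "finite A" "finite U" and sub: "A \<subseteq> V" "U \<subseteq> V"
      using Cons.prems(1) finite_subset[OF _ \<open>finite V\<close>] by (auto simp: U_def intro!: finite_Union)
    have ne: "A \<noteq> {}" "U \<noteq> {}" using Cons.prems(1) False by (auto simp: U_def neq_Nil_conv)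
    have disj: "A \<inter> U = {}" using Cons.prems(2) by (auto simp: U_def disjnt_def)
    \<comment> \<open>The weights on \<open>A\<close> and on \<open>U\<close> add up to 1 and -1. As
      \<open>h\<close> is constant on \<open>U\<close>, it is orthogonal to all contrasts obtained
      from the later sets.\<close>
    define h where "h v = (if v \<in> A then 1 / real (card A) else if v \<in> U then - 1 / real (card U) else 0)"
      for v
    have hA: "h v = 1 / real (card A)" if "v \<in> A" for v using that by (simp add: h_def)
    have hU: "h v = - 1 / real (card U)" if "v \<in> U" for v using that disj by (auto simp: h_def)
    have "(\<Sum>v\<in>V. h v) = (\<Sum>v\<in>A \<union> U. h v)"
      using sub \<open>finite V\<close> by (intro sum.mono_neutral_right) (auto simp: h_def)
    also have "\<dots> = (\<Sum>v\<in>A. h v) + (\<Sum>v\<in>U. h v)"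
      by (rule sum.union_disjoint[OF fin disj])
    also have "\<dots> = 0" using ne fin by (simp add: hA hU)
    finally have h0: "(\<Sum>v\<in>V. h v) = 0" .
    have hc: "contrast_on V (A \<union> U) h" using h0 by (auto simp: contrast_on_def h_def)
    have hconst: "const_on B h" if "B \<in> set (A # As)" for B
    proof (cases "B = A")
      case False
      with that have "B \<subseteq> U" by (auto simp: U_def)
      then show ?thesis using hU by (auto simp: const_on_def subset_iff)
    qed (simp add: const_on_def hA)
    have hconstU: "const_on U h" by (simp add: const_on_def hU)
    have fs0: "f v = 0" if "f \<in> set fs" "v \<notin> U" for f v
      using fs(3)[OF that(1)] that(2) by (auto simp: contrast_on_def U_def)
    have orth: "(\<Sum>v\<in>V. h v * f v) = 0" if "f \<in> set fs" for f
      using contrast_const_orthogonal[OF fs(3)[OF that] hconstU[unfolded U_def]]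
      by (simp add: mult.commute)
    have "orthogonal_list V (h # fs)"
    proof -
      obtain a where "a \<in> A" using ne by auto
      then have "\<exists>v\<in>V. h v \<noteq> 0" using sub fin by (intro bexI[of _ a]) (auto simp: hA)
      then show ?thesis using fs(2) orth by (auto simp: orthogonal_list_def)
    qed
    moreover have "contrast_on V (\<Union>(set (A # As))) f" if "f \<in> set (h # fs)" for f
      using that hc fs(3) by (auto simp: contrast_on_def U_def)
    moreover have "const_on B f" if "f \<in> set (h # fs)" "B \<in> set (A # As)" for f B
    proof (cases "f = h")
      case False
      with that have f: "f \<in> set fs" by simp
      show ?thesis
      proof (cases "B \<in> set As")
        \<comment> \<open>The contrasts from the later sets live on \<open>U\<close> and are zero on
          the new set \<open>A\<close>.\<close>
        case False
        with that have "B = A" by simp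
        moreover have "f v = 0" if "v \<in> A" for v using that disj fs0[OF f] by blast
        ultimately show ?thesis by (simp add: const_on_def)
      qed (use fs(4)[OF f] in simp)
    qed (use that(2) hconst in simp)
    moreover have "length (h # fs) = length (A # As) - 1" using fs(1) False by (cases As) auto
    ultimately show ?thesis by blast
  qed
qed

text \<open>Helmert contrasts of the singletons of \<open>A\<close>. For empty \<open>A\<close> the
  truncated subtraction gives the empty list.\<close>

lemma point_contrasts:
  assumes "finite V" "A \<subseteq> V"
  shows "\<exists>fs. length fs = card A - 1 \<and> orthogonal_list V fs \<and> (\<forall>f\<in>set fs. contrast_on V A f)"
proof -
  obtain xs where xs: "set xs = A" "distinct xs"
    using finite_distinct_list finite_subset assms by metis
  have "sorted_wrt disjnt (map (\<lambda>x. {x}) xs)"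
    using xs(2) by (auto simp: sorted_wrt_map disjnt_def distinct_conv_nth sorted_wrt_iff_nth_less)
  then have "\<exists>fs. length fs = length (map (\<lambda>x. {x}) xs) - 1 \<and> orthogonal_list V fs \<and>
      (\<forall>f\<in>set fs. contrast_on V (\<Union>(set (map (\<lambda>x. {x}) xs))) f \<and>
        (\<forall>B\<in>set (map (\<lambda>x. {x}) xs). const_on B f))"
    using assms xs by (intro helmert_contrasts) auto
  then obtain fs where "length fs = length (map (\<lambda>x. {x}) xs) - 1" "orthogonal_list V fs"
    "\<forall>f\<in>set fs. contrast_on V (\<Union>(set (map (\<lambda>x. {x}) xs))) f" by blast
  then show ?thesis using xs distinct_card[of xs] by auto
qed

section \<open>Expansion by true twins\<close>

text \<open>The labels are the vertices of a pattern graph with closed adjacency \<open>R\<close>;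
  for reflexive \<open>R\<close>, distinct vertices with the same label are true twins.\<close>

definition twin_expansion :: "('b \<Rightarrow> 'b \<Rightarrow> bool) \<Rightarrow> 'a set \<Rightarrow> ('a \<Rightarrow> 'b) \<Rightarrow> 'a pair_pre_digraph" where
  "twin_expansion R V lab = \<lparr>pverts = V, parcs = {(u, v). u \<in> V \<and> v \<in> V \<and> u \<noteq> v \<and> R (lab u) (lab v)}\<rparr>"

lemma twin_expansion_simps [simp]:
  "pverts (twin_expansion R V lab) = V"
  "(u, v) \<in> parcs (twin_expansion R V lab) \<longleftrightarrow> u \<in> V \<and> v \<in> V \<and> u \<noteq> v \<and> R (lab u) (lab v)"
  by (auto simp: twin_expansion_def)

lemma pair_graph_twin_expansion:
  assumes "finite V" "symp R"
  shows "pair_graph (twin_expansion R V lab)"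
proof
  show "finite (parcs (twin_expansion R V lab))"
    by (rule finite_subset[of _ "V \<times> V"]) (use assms(1) in auto)
  show "symmetric (with_proj (twin_expansion R V lab))"
    using assms(2) by (auto simp: symmetric_def sym_def symp_def)
qed (use assms(1) in auto)

text \<open>Reflexivity adds \<open>v\<close> itself to the index set, with the term
  \<open>f v - f v = 0\<close>. The resulting closed neighbourhood is determined by the label of
  \<open>v\<close> alone.\<close>

lemma laplacian_twin_expansion:
  assumes "finite V" "reflp R" "v \<in> V"
  shows "laplacian (twin_expansion R V lab) f v = (\<Sum>u\<in>{u\<in>V. R (lab v) (lab u)}. f v - f u)"
proof -
  have "{u\<in>V. R (lab v) (lab u)} = insert v (nbhd (twin_expansion R V lab) v)"
    using assms by (auto simp: nbhd_def reflp_def)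
  moreover have "finite (nbhd (twin_expansion R V lab) v)"
    by (rule finite_subset[OF _ assms(1)]) (auto simp: nbhd_def)
  ultimately show ?thesis by (simp add: laplacian_def nbhd_def)
qed

text \<open>A function of sum zero supported on a class of true twins is an eigenfunction; so only
  functions that are constant on the classes remain to be found.\<close>

lemma spectrum_twin_expansion:
  fixes V :: "'a::linorder set" and lab :: "'a \<Rightarrow> 'b" and hs :: "(real \<times> ('a \<Rightarrow> real)) list"
  assumes V: "finite V" and R: "reflp R" "symp R"
    and len: "length hs = card (lab ` V)"
    and eig: "\<And>l f v. (l, f) \<in> set hs \<Longrightarrow> v \<in> V \<Longrightarrow> laplacian (twin_expansion R V lab) f v = l * f v"
    and orth: "orthogonal_list V (map snd hs)"
    and const: "\<And>l f a. (l, f) \<in> set hs \<Longrightarrow> const_on {v\<in>V. lab v = a} f"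
    and deg: "\<And>v. v \<in> V \<Longrightarrow> real (card {u\<in>V. R (lab v) (lab u)}) = e (lab v)"
  shows "laplacian_spectrum (twin_expansion R V lab) = mset (map fst hs) +
    (\<Sum>a\<in>lab ` V. replicate_mset (card {v\<in>V. lab v = a} - 1) (e a))"
proof -
  let ?G = "twin_expansion R V lab"
  define cls where "cls a = {v\<in>V. lab v = a}" for a
  have "\<exists>H. length H = card (cls a) - 1 \<and> orthogonal_list V H \<and> (\<forall>f\<in>set H. contrast_on V (cls a) f)" for a
    by (rule point_contrasts[OF V]) (auto simp: cls_def)
  then obtain H where H: "\<And>a. length (H a) = card (cls a) - 1" "\<And>a. orthogonal_list V (H a)"
    "\<And>a f. f \<in> set (H a) \<Longrightarrow> contrast_on V (cls a) f" by metis
  obtain as where as: "set as = lab ` V" "distinct as"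
    using finite_distinct_list V by (metis finite_imageI)
  \<comment> \<open>All contrasts within single classes, each paired with the closed neighbourhood
    size \<open>e a\<close> of its class.\<close>
  define gs where "gs bs = concat (map (\<lambda>a. map (Pair (e a)) (H a)) bs)" for bs
  have gsD: "\<exists>a\<in>set bs. l = e a \<and> f \<in> set (H a)" if "(l, f) \<in> set (gs bs)" for l f bs
    using that by (auto simp: gs_def)
  have const_other: "const_on (cls a) f" if "contrast_on V (cls b) f" "a \<noteq> b" for a b f
    using that by (auto simp: const_on_def contrast_on_def cls_def)
  have orth_gs: "orthogonal_list V (map snd (gs bs))" if "distinct bs" for bs
    using that
  proof (induction bs)
    case Nil
    then show ?case by (simp add: gs_def orthogonal_list_def)
  next
    case (Cons b bs)
    have "(\<Sum>v\<in>V. f v * g v) = 0" if f: "f \<in> set (H b)" and g: "(l, g) \<in> set (gs bs)" for f l g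
    proof -
      obtain a where a: "a \<in> set bs" "g \<in> set (H a)" using gsD[OF g] by auto
      with Cons.prems have "const_on (cls b) g" by (intro const_other[OF H(3)]) auto
      then show ?thesis by (rule contrast_const_orthogonal[OF H(3)[OF f]])
    qed
    moreover have "map snd (gs (b # bs)) = H b @ map snd (gs bs)" by (simp add: gs_def comp_def)
    ultimately show ?case using Cons H(2) by (auto simp: orthogonal_list_append)
  qed
  have eig_gs: "laplacian ?G f v = l * f v" if lf: "(l, f) \<in> set (gs as)" and v: "v \<in> V" for l f v
  proof -
    obtain a where a: "l = e a" "f \<in> set (H a)" using gsD[OF lf] by auto
    note f = H(3)[OF a(2)]
    let ?N = "{u\<in>V. R (lab v) (lab u)}"
    have "laplacian ?G f v = real (card ?N) * f v - (\<Sum>u\<in>?N. f u)"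
      using V R(1) v by (simp add: laplacian_twin_expansion sum_subtractf)
    \<comment> \<open>A closed neighbourhood contains class \<open>a\<close> entirely or not at all,
      so a contrast on that class sums to zero over it in either case.\<close>
    moreover have "(\<Sum>u\<in>?N. f u) = (if R (lab v) a then \<Sum>u\<in>V. f u else 0)"
    proof (cases "R (lab v) a")
      case True
      then have "(\<Sum>u\<in>?N. f u) = (\<Sum>u\<in>V. f u)"
        using V f by (intro sum.mono_neutral_left) (auto simp: contrast_on_def cls_def)
      with True show ?thesis by simp
    next
      case False
      with f show ?thesis by (auto simp: contrast_on_def cls_def intro!: sum.neutral)
    qed
    moreover have "real (card ?N) * f v = l * f v"
      using a(1) deg[OF v] f v by (cases "lab v = a") (auto simp: contrast_on_def cls_def)
    ultimately show ?thesis using f by (simp add: contrast_on_def)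
  qed
  have lengs: "mset (map fst (gs as)) = (\<Sum>a\<in>lab ` V. replicate_mset (card (cls a) - 1) (e a))"
  proof -
    have "mset (map fst (gs bs)) = (\<Sum>a\<leftarrow>bs. replicate_mset (card (cls a) - 1) (e a))" for bs
      by (induction bs) (auto simp: gs_def comp_def H(1) map_replicate_const)
    then show ?thesis using as by (simp add: sum_list_distinct_conv_sum_set)
  qed
  have pos: "card (cls a) > 0" if "a \<in> lab ` V" for a
    using that V by (auto simp: cls_def card_gt_0_iff)
  \<comment> \<open>Each class of size \<open>c\<close> yields \<open>c - 1\<close> contrasts, and
    \<open>hs\<close> supplies one more function per class; together they number
    \<open>card V\<close>.\<close>
  have "length (gs as) = size (mset (map fst (gs as)))" by (simp del: mset_map)
  also have "\<dots> = (\<Sum>a\<in>lab ` V. card (cls a) - 1)" by (simp only: lengs size_multiset_sum size_replicate_mset)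
  finally have "length (hs @ gs as) = (\<Sum>a\<in>lab ` V. card (cls a) - 1) + (\<Sum>a\<in>lab ` V. 1)"
    using len by simp
  also have "\<dots> = (\<Sum>a\<in>lab ` V. card (cls a))"
    unfolding sum.distrib[symmetric] using pos by (intro sum.cong) (auto simp: Suc_leI)
  also have "\<dots> = card (\<Union>a\<in>lab ` V. cls a)"
    by (rule card_UN_disjoint[symmetric]) (use V in \<open>auto simp: cls_def\<close>)
  also have "(\<Union>a\<in>lab ` V. cls a) = V" by (auto simp: cls_def)
  finally have length: "length (hs @ gs as) = card V" .
  have "(\<Sum>v\<in>V. g v * f v) = 0" if g: "(l, g) \<in> set hs" and f: "(m, f) \<in> set (gs as)" for l m f g
  proof -
    obtain a where "f \<in> set (H a)" using gsD[OF f] by auto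
    then have "contrast_on V (cls a) f" by (rule H(3))
    from contrast_const_orthogonal[OF this const[OF g, folded cls_def]]
    show ?thesis by (simp add: mult.commute)
  qed
  then have "orthogonal_list V (map snd (hs @ gs as))"
    using orth orth_gs[OF as(2)] by (auto simp: orthogonal_list_append)
  with length eig eig_gs have "laplacian_spectrum ?G = mset (map fst (hs @ gs as))"
    by (intro laplacian_spectrum_eqI pair_graph_twin_expansion V R(2)) auto
  then show ?thesis by (simp add: lengs[unfolded cls_def] del: mset_map)
qed

section \<open>Separation and block graphs\<close>

text \<open>Applied to disprove reachability: it suffices to find a set closed under arcs that
  contains \<open>u\<close> but not \<open>v\<close>.\<close>

lemma reachable_closed:
  assumes "u \<rightarrow>\<^sup>*\<^bsub>H\<^esub> v" "u \<in> C" "\<And>x y. x \<rightarrow>\<^bsub>H\<^esub> y \<Longrightarrow> x \<in> C \<Longrightarrow> y \<in> C"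
  shows "v \<in> C"
  using assms(1,2) unfolding reachable_def
  by (induction rule: rtrancl_on_induct) (use assms(3) in auto)

lemma reachable_mono_set:
  assumes "u \<rightarrow>\<^sup>*\<^bsub>H\<^esub> v" "verts H \<subseteq> verts K" "arcs_ends H \<subseteq> arcs_ends K"
  shows "u \<rightarrow>\<^sup>*\<^bsub>K\<^esub> v"
  using assms(1) unfolding reachable_def
  by (induction rule: rtrancl_on_induct)
     (use assms(2,3) in \<open>auto intro: rtrancl_on_into_rtrancl_on\<close>)

lemma arcs_ends_induce:
  "arcs_ends (with_proj G \<restriction> B) = {(u, v) \<in> parcs G. u \<in> B \<and> v \<in> B}"
  by (auto simp: arcs_ends_conv)

lemma reachable_path2:
  assumes "(u, w) \<in> parcs G" "(w, v) \<in> parcs G" "{u, w, v} \<subseteq> B"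
  shows "u \<rightarrow>\<^sup>*\<^bsub>with_proj G \<restriction> B\<^esub> v"
proof -
  let ?H = "with_proj G \<restriction> B"
  have "(u, u) \<in> rtrancl_on (verts ?H) (arcs_ends ?H)" using assms(3) by auto
  then have "(u, w) \<in> rtrancl_on (verts ?H) (arcs_ends ?H)"
    by (rule rtrancl_on_into_rtrancl_on) (use assms in \<open>auto simp: arcs_ends_induce\<close>)
  then have "(u, v) \<in> rtrancl_on (verts ?H) (arcs_ends ?H)"
    by (rule rtrancl_on_into_rtrancl_on) (use assms in \<open>auto simp: arcs_ends_induce\<close>)
  then show ?thesis by (simp add: reachable_def)
qed

text \<open>\<open>connected\<close> is defined through the symmetric closure, which adds no arcs to
  an induced subgraph of a symmetric graph.\<close>

lemma connected_reachable:
  assumes "pair_graph G" "connected (with_proj G \<restriction> B)" "u \<in> B" "v \<in> B"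
  shows "u \<rightarrow>\<^sup>*\<^bsub>with_proj G \<restriction> B\<^esub> v"
proof -
  interpret pair_graph G by (rule assms(1))
  have "arcs_ends (with_proj (mk_symmetric (with_proj G \<restriction> B))) \<subseteq> arcs_ends (with_proj G \<restriction> B)"
    using arcs_symmetric by (auto simp: parcs_mk_symmetric arcs_ends_induce)
  moreover have r: "u \<rightarrow>\<^sup>*\<^bsub>with_proj (mk_symmetric (with_proj G \<restriction> B))\<^esub> v"
    using assms(2-4) by (auto simp: connected_def strongly_connected_def)
  ultimately show ?thesis by (intro reachable_mono_set[OF r]) auto
qed

text \<open>If a block contained two non-adjacent vertices, the vertex \<open>a\<close> separating
  them in \<open>G\<close> would be a cut vertex of the block.\<close>

lemma block_graphI:
  assumes G: "pair_graph G" and conn: "connected (with_proj G)"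
    and sep: "\<And>u v. u \<in> pverts G \<Longrightarrow> v \<in> pverts G \<Longrightarrow> u \<noteq> v \<Longrightarrow> (u, v) \<notin> parcs G \<Longrightarrow>
      \<exists>a. separates G {a} u v"
  shows "block_graph G"
  unfolding block_graph_def
proof (intro conjI allI impI G conn)
  fix B assume B: "is_block G B"
  let ?H = "with_proj G \<restriction> B"
  have sub: "B \<subseteq> pverts G" and H: "connected ?H" "\<And>a. \<not> cut_vertex ?H a"
    using B by (auto simp: is_block_def nonseparable_def)
  show "is_clique G B"
  proof (rule ccontr)
    assume "\<not> is_clique G B"
    then obtain u v where uv: "u \<in> B" "v \<in> B" "u \<noteq> v" "(u, v) \<notin> parcs G"
      using sub by (auto simp: is_clique_def)
    with sep[of u v] sub obtain a where a: "separates G {a} u v" by auto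
    let ?K = "with_proj G \<restriction> (pverts G - {a})"
    have K: "\<not> u \<rightarrow>\<^sup>*\<^bsub>?K\<^esub> v" "u \<noteq> a" "v \<noteq> a" using a by (auto simp: separates_def)
    have r: "u \<rightarrow>\<^sup>*\<^bsub>?H\<^esub> v" by (rule connected_reachable[OF G H(1) uv(1,2)])
    \<comment> \<open>Otherwise the whole block survives the deletion of \<open>a\<close> and still
      joins \<open>u\<close> to \<open>v\<close>.\<close>
    have "a \<in> B"
    proof (rule ccontr)
      assume "a \<notin> B"
      with sub have "u \<rightarrow>\<^sup>*\<^bsub>?K\<^esub> v"
        by (intro reachable_mono_set[OF r]) (auto simp: arcs_ends_induce)
      with K show False by simp
    qed
    moreover have "\<not> u \<rightarrow>\<^sup>*\<^bsub>pre_digraph.del_vert ?H a\<^esub> v"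
    proof
      assume r': "u \<rightarrow>\<^sup>*\<^bsub>pre_digraph.del_vert ?H a\<^esub> v"
      have "u \<rightarrow>\<^sup>*\<^bsub>?K\<^esub> v"
        using sub by (intro reachable_mono_set[OF r']) (auto simp: arcs_ends_conv pre_digraph.del_vert_simps)
      with K show False by simp
    qed
    ultimately have "cut_vertex ?H a"
      unfolding cut_vertex_def using r uv K by auto
    with H(2) show False by simp
  qed
qed

lemma add_true_twin_twin_expansion:
  assumes "reflp R" "symp R" "v \<in> V" "v' \<notin> V" "lab v' = lab v"
  shows "add_true_twin (twin_expansion R V lab) v v' = twin_expansion R (insert v' V) lab"
proof (rule pair_pre_digraph.equality)
  show "parcs (add_true_twin (twin_expansion R V lab) v v') =
      parcs (twin_expansion R (insert v' V) lab)"
    using assms by (auto simp: add_true_twin_def twin_expansion_def nbhd_def reflp_def symp_def)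
qed (auto simp: add_true_twin_def)

text \<open>Vertices with a repeated label are removed one at a time; putting such a vertex back
  adds a true twin. The process ends with one vertex per label, where the assumption
  \<open>base\<close> applies.\<close>

lemma strictly_chordal_twin_expansion:
  assumes R: "reflp R" "symp R" and V: "finite V"
    and base: "\<And>W. W \<subseteq> V \<Longrightarrow> inj_on lab W \<Longrightarrow> lab ` W = lab ` V \<Longrightarrow>
      block_graph (twin_expansion R W lab)"
  shows "strictly_chordal (twin_expansion R V lab)"
  using V base
proof (induction "card V" arbitrary: V rule: less_induct)
  case less
  show ?case
  proof (cases "inj_on lab V")
    case True
    then show ?thesis using less.prems(2) by (intro strictly_chordal.block) auto
  next
    case False
    then obtain v v' where v: "v \<in> V" "v' \<in> V" "v \<noteq> v'" "lab v' = lab v"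
      by (auto simp: inj_on_def)
    \<comment> \<open>The remaining vertex \<open>v\<close> keeps the label in use, so a set of
      representatives for the smaller set also represents the labels of \<open>V\<close>.\<close>
    have im: "lab ` (V - {v'}) = lab ` V" using v by (auto simp: image_iff)
    have "strictly_chordal (twin_expansion R (V - {v'}) lab)"
    proof (rule less.hyps)
      show "card (V - {v'}) < card V" using v less.prems(1) by (intro psubset_card_mono) auto
    next
      fix W assume "W \<subseteq> V - {v'}" "inj_on lab W" "lab ` W = lab ` (V - {v'})"
      then show "block_graph (twin_expansion R W lab)"
        using less.prems(2)[of W] im by auto
    qed (use less.prems(1) in simp)
    then have "strictly_chordal (add_true_twin (twin_expansion R (V - {v'}) lab) v v')"
      by (rule strictly_chordal.twin) (use v in auto)
    also have "add_true_twin (twin_expansion R (V - {v'}) lab) v v' = twin_expansion R V lab"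
      using v R by (subst add_true_twin_twin_expansion) (auto simp: insert_absorb)
    finally show ?thesis .
  qed
qed

section \<open>The double star and its expansions\<close>

text \<open>The vertices of a double star: \<open>Core i\<close> is the centre of side
  \<open>i\<close> and \<open>Leaf i k\<close> its \<open>k\<close>-th leaf, which stands for a
  whole clique after expansion. The side opposite to \<open>i\<close> is
  \<open>\<not> i\<close>.\<close>

datatype label = Core bool | Leaf bool nat

fun star_rel :: "label \<Rightarrow> label \<Rightarrow> bool" where
  "star_rel (Core i) (Core j) = True"
| "star_rel (Core i) (Leaf j k) = (i = j)"
| "star_rel (Leaf i k) (Core j) = (i = j)"
| "star_rel (Leaf i k) (Leaf j l) = (i = j \<and> k = l)"

lemma reflp_star_rel: "reflp star_rel"
proof (rule reflpI)
  show "star_rel a a" for a by (cases a) auto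
qed

lemma symp_star_rel: "symp star_rel"
proof (rule sympI)
  show "star_rel a b \<Longrightarrow> star_rel b a" for a b by (cases "(a, b)" rule: star_rel.cases) auto
qed

section \<open>Separators, interval model and membership in \<open>SI_core\<close>\<close>

locale double_star =
  fixes V :: "'a set" and lab :: "'a \<Rightarrow> label"
  assumes finite_V: "finite V" and core_nonempty: "Core i \<in> lab ` V"
begin

abbreviation "G \<equiv> twin_expansion star_rel V lab"

abbreviation core :: "bool \<Rightarrow> 'a set" where
  "core i \<equiv> {v\<in>V. lab v = Core i}"

abbreviation leaves :: "bool \<Rightarrow> 'a set" where
  "leaves i \<equiv> {v\<in>V. \<exists>k. lab v = Leaf i k}"

lemma pair_graph_G: "pair_graph G"
  by (rule pair_graph_twin_expansion[OF finite_V symp_star_rel])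

text \<open>A leaf class has outside neighbours only in its own core; once that core is deleted, no
  arc enters or leaves the class.\<close>

lemma separates_leaf_class:
  assumes "v \<in> V" "w \<in> V" "lab v = Leaf i k" "lab w \<noteq> Leaf i k" "lab w \<noteq> Core i"
  shows "separates G (core i) v w" "separates G (core i) w v"
proof -
  let ?H = "with_proj G \<restriction> (pverts G - core i)"
  let ?C = "{x. lab x = Leaf i k}"
  have arc: "x \<in> ?C \<longleftrightarrow> y \<in> ?C" if "x \<rightarrow>\<^bsub>?H\<^esub> y" for x y
    using that by (cases "(lab x, lab y)" rule: star_rel.cases) (auto simp: arcs_ends_induce)
  have "\<not> v \<rightarrow>\<^sup>*\<^bsub>?H\<^esub> w"
    using reachable_closed[of ?H v w ?C] arc assms(3,4) by blast
  moreover have "\<not> w \<rightarrow>\<^sup>*\<^bsub>?H\<^esub> v"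
    using reachable_closed[of ?H w v "- ?C"] arc assms(3,4) by blast
  ultimately show "separates G (core i) v w" "separates G (core i) w v"
    using assms by (auto simp: separates_def)
qed

text \<open>The only ways around a set that contains neither core are the paths through one vertex of
  the relevant core, or through one vertex of each of them.\<close>

lemma core_subset_separator:
  assumes uv: "u \<in> V" "v \<in> V" "u \<noteq> v" "(u, v) \<notin> parcs G" and S: "separates G S u v"
  shows "\<exists>i. core i \<subseteq> S \<and> separates G (core i) u v"
proof -
  let ?H = "with_proj G \<restriction> (pverts G - S)"
  have in_H: "u \<in> V - S" "v \<in> V - S" using uv S by (auto simp: separates_def)
  have no: "\<not> u \<rightarrow>\<^sup>*\<^bsub>?H\<^esub> v" using S by (simp add: separates_def)
  have sub1: "core i \<subseteq> S" if "star_rel (lab u) (Core i)" "star_rel (Core i) (lab v)"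
    "lab u \<noteq> Core i" "lab v \<noteq> Core i" for i
  proof (rule ccontr)
    assume "\<not> core i \<subseteq> S"
    then obtain w where w: "w \<in> V" "lab w = Core i" "w \<notin> S" by auto
    have "u \<rightarrow>\<^sup>*\<^bsub>?H\<^esub> v"
      by (rule reachable_path2[of _ w]) (use w uv that in_H in auto)
    with no show False ..
  qed
  have sub2: "core i \<subseteq> S \<or> core (\<not> i) \<subseteq> S" if "lab u = Leaf i k" "lab v = Leaf (\<not> i) l" for i k l
  proof (rule ccontr)
    assume "\<not> (core i \<subseteq> S \<or> core (\<not> i) \<subseteq> S)"
    then obtain w x where w: "w \<in> V" "lab w = Core i" "w \<notin> S"
      and x: "x \<in> V" "lab x = Core (\<not> i)" "x \<notin> S" by auto
    have "w \<noteq> x" using w x by auto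
    then have "u \<rightarrow>\<^sup>*\<^bsub>?H\<^esub> x"
      by (intro reachable_path2[of _ w]) (use w x uv that in_H in auto)
    then have "u \<rightarrow>\<^sup>*\<^bsub>?H\<^esub> v"
      unfolding reachable_def
      by (rule rtrancl_on_into_rtrancl_on) (use x uv that in_H in \<open>auto simp: arcs_ends_induce\<close>)
    with no show False ..
  qed
  have inc: "\<not> star_rel (lab u) (lab v)" using uv by simp
  then consider (cl) i k j where "lab u = Core j" "lab v = Leaf i k" "i \<noteq> j"
    | (lc) i k j where "lab u = Leaf i k" "lab v = Core j" "i \<noteq> j"
    | (same) i k l where "lab u = Leaf i k" "lab v = Leaf i l" "k \<noteq> l"
    | (opp) i k l where "lab u = Leaf i k" "lab v = Leaf (\<not> i) l"
    by (cases "(lab u, lab v)" rule: star_rel.cases) auto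
  then show ?thesis
  proof cases
    case (cl i k j)
    then show ?thesis using sub1[of i] separates_leaf_class(2)[OF uv(2,1) cl(2)] by fastforce
  next
    case (lc i k j)
    then show ?thesis using sub1[of i] separates_leaf_class(1)[OF uv(1,2) lc(1)] by fastforce
  next
    case (same i k l)
    then show ?thesis using sub1[of i] separates_leaf_class(1)[OF uv(1,2) same(1)] by fastforce
  next
    \<comment> \<open>Between leaves on opposite sides each core separates, so whichever core lies
      in \<open>S\<close> can be chosen.\<close>
    case (opp i k l)
    then show ?thesis
      using sub2[OF opp] separates_leaf_class(1)[OF uv(1,2) opp(1)]
        separates_leaf_class(2)[OF uv(2,1) opp(2)] by (cases "core i \<subseteq> S") auto
  qed
qed

text \<open>Each vertex equals or is adjacent to the chosen core vertex \<open>a i\<close> of its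
  side, and the two chosen vertices are adjacent.\<close>

lemma connected_G: "connected (with_proj G)"
proof -
  obtain a where a: "\<And>i. a i \<in> V" "\<And>i. lab (a i) = Core i"
    using core_nonempty unfolding image_iff by metis
  interpret pair_graph G by (rule pair_graph_G)
  define side where "side v = (case lab v of Core i \<Rightarrow> i | Leaf i k \<Rightarrow> i)" for v
  have hub: "v \<rightarrow>\<^sup>*\<^bsub>with_proj G\<^esub> a (side v)" if "v \<in> V" for v
  proof (cases "v = a (side v)")
    case True
    with that a show ?thesis by (metis reachable_refl twin_expansion_simps(1))
  next
    case False
    with that a show ?thesis by (intro reachable_adjI) (auto simp: side_def split: label.splits)
  qed
  have hubs: "a i \<rightarrow>\<^sup>*\<^bsub>with_proj G\<^esub> a j" for i j
  proof (cases "i = j")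
    case False
    then have "a i \<noteq> a j" using a(2) by (metis label.inject(1))
    then show ?thesis using a by (intro reachable_adjI) auto
  qed (simp add: a)
  have "strongly_connected (with_proj G)"
  proof (rule strongly_connectedI)
    fix u v assume "u \<in> verts (with_proj G)" "v \<in> verts (with_proj G)"
    then have "u \<in> V" "v \<in> V" by auto
    then show "u \<rightarrow>\<^sup>*\<^bsub>with_proj G\<^esub> v"
      by (meson hub hubs reachable_trans symmetric_reachable')
  qed (use a in auto)
  then show ?thesis
    unfolding connected_def strongly_connected_def using reachable_mk_symmetricI by auto
qed

text \<open>Two non-adjacent vertices are separated by the set of all other vertices, hence, by
  \<open>core_subset_separator\<close>, by a core. With injective labels a core is a single
  vertex.\<close>

lemma block_graph_G:
  assumes "inj_on lab V"
  shows "block_graph G"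
proof (rule block_graphI[OF pair_graph_G connected_G])
  fix u v assume uv: "u \<in> pverts G" "v \<in> pverts G" "u \<noteq> v" "(u, v) \<notin> parcs G"
  let ?S = "pverts G - {u, v}"
  have "\<not> u \<rightarrow>\<^sup>*\<^bsub>with_proj G \<restriction> (pverts G - ?S)\<^esub> v"
    using reachable_closed[of "with_proj G \<restriction> (pverts G - ?S)" u v "{u}"] uv
    by (auto simp: arcs_ends_induce)
  then have "separates G ?S u v" by (auto simp: separates_def)
  with uv obtain i where i: "separates G (core i) u v"
    using core_subset_separator[of u v ?S] by auto
  obtain a where "a \<in> V" "lab a = Core i" using core_nonempty[of i] by auto
  with assms have "core i = {a}" by (auto simp: inj_on_def)
  with i show "\<exists>a. separates G {a} u v" by auto
qed

lemma strictly_chordal_G: "strictly_chordal G"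
proof (rule strictly_chordal_twin_expansion[OF reflp_star_rel symp_star_rel finite_V])
  fix W assume W: "W \<subseteq> V" "inj_on lab W" "lab ` W = lab ` V"
  interpret W: double_star W lab
    by unfold_locales (use W finite_V core_nonempty in \<open>auto intro: finite_subset\<close>)
  show "block_graph (twin_expansion star_rel W lab)" by (rule W.block_graph_G[OF W(2)])
qed

text \<open>The cores become the intervals from \<open>-N\<close> to 0 and from 0 to
  \<open>N\<close>, which meet in 0. The leaf class \<open>k\<close> becomes the point
  \<open>k + 1\<close> or \<open>-(k + 1)\<close>; the shift by one keeps it away from 0, hence out
  of the opposite core.\<close>

lemma interval_graph_G: "interval_graph G"
proof -
  \<comment> \<open>Larger than every leaf index, so that all leaf points lie in the interval of
    their core.\<close>
  define N where "N = Suc (Max ((\<lambda>v. case lab v of Core i \<Rightarrow> 0 | Leaf i k \<Rightarrow> k) ` V))"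
  have N: "k < N" if "v \<in> V" "lab v = Leaf i k" for v i k
    using that finite_V unfolding N_def less_Suc_eq_le
    by (intro Max_ge) (auto intro!: image_eqI[of _ _ v])
  define l :: "'a \<Rightarrow> real" where "l v = (case lab v of Core i \<Rightarrow> if i then 0 else - real N
    | Leaf i k \<Rightarrow> if i then real (Suc k) else - real (Suc k))" for v
  define r :: "'a \<Rightarrow> real" where "r v = (case lab v of Core i \<Rightarrow> if i then real N else 0
    | Leaf i k \<Rightarrow> if i then real (Suc k) else - real (Suc k))" for v
  have "(u, v) \<in> parcs G \<longleftrightarrow> {l u..r u} \<inter> {l v..r v} \<noteq> {}"
    if "u \<in> V" "v \<in> V" "u \<noteq> v" for u v
  proof -
    have "{l u..r u} \<inter> {l v..r v} \<noteq> {} \<longleftrightarrow> max (l u) (l v) \<le> min (r u) (r v)" by auto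
    also have "\<dots> \<longleftrightarrow> star_rel (lab u) (lab v)"
      using N[OF that(1)] N[OF that(2)]
      by (cases "(lab u, lab v)" rule: star_rel.cases)
         (auto simp: l_def r_def max_def min_def simp flip: of_nat_Suc split: if_splits)
    finally show ?thesis using that by simp
  qed
  moreover have "\<forall>v\<in>V. l v \<le> r v" by (auto simp: l_def r_def split: label.splits)
  ultimately show ?thesis
    unfolding interval_graph_def twin_expansion_simps(1) using pair_graph_G by blast
qed

text \<open>A separator contains a core that separates the same pair, so a minimal one equals that
  core. Conversely, core \<open>i\<close> is minimal between a leaf of side \<open>i\<close> and a
  vertex of the other core: a smaller separator would contain a full core, but the cores are
  disjoint and nonempty.\<close>

lemma minimal_vertex_separators_G:
  assumes leaf: "\<And>i. leaves i \<noteq> {}"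
  shows "{S. minimal_vertex_separator G S} = {core False, core True}"
proof (intro equalityI subsetI)
  fix S assume "S \<in> {S. minimal_vertex_separator G S}"
  then obtain u v where uv: "u \<in> V" "v \<in> V" "u \<noteq> v" "(u, v) \<notin> parcs G"
    and S: "separates G S u v" "\<And>S'. S' \<subset> S \<Longrightarrow> \<not> separates G S' u v"
    by (auto simp: minimal_vertex_separator_def)
  obtain i where "core i \<subseteq> S" "separates G (core i) u v"
    using core_subset_separator[OF uv S(1)] by auto
  with S(2) have "S = core i" by blast
  then show "S \<in> {core False, core True}" by (cases i) auto
next
  fix S assume "S \<in> {core False, core True}"
  then obtain i where i: "S = core i" by auto
  obtain u k where u: "u \<in> V" "lab u = Leaf i k" using leaf[of i] by auto
  obtain v where v: "v \<in> V" "lab v = Core (\<not> i)" using core_nonempty[of "\<not> i"] by auto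
  have uv: "u \<noteq> v" "(u, v) \<notin> parcs G" using u v by auto
  have "\<not> separates G S' u v" if "S' \<subset> S" for S'
  proof
    assume S': "separates G S' u v"
    obtain j where j: "core j \<subseteq> S'"
      using core_subset_separator[OF u(1) v(1) uv S'] by auto
    obtain w where "w \<in> V" "lab w = Core j" using core_nonempty[of j] by auto
    with j that i have "j = i" by auto
    with j that i show False by auto
  qed
  moreover have "separates G S u v"
    unfolding i by (rule separates_leaf_class(1)[OF u(1) v(1) u(2)]) (use v in auto)
  ultimately show "S \<in> {S. minimal_vertex_separator G S}"
    unfolding minimal_vertex_separator_def
    by (intro CollectI bexI[of _ u] bexI[of _ v] conjI uv) (use u v in auto)
qed

text \<open>A larger clique would contain a leaf, which is not adjacent to the opposite
  core.\<close>

lemma maximal_clique_cores: "maximal_clique G (core False \<union> core True)"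
  unfolding maximal_clique_def
proof (intro conjI allI impI notI)
  show "is_clique G (core False \<union> core True)" by (auto simp: is_clique_def)
  fix K assume K: "is_clique G K" "core False \<union> core True \<subset> K"
  then obtain v where v: "v \<in> K" "v \<in> V" "v \<notin> core False \<union> core True"
    by (auto simp: is_clique_def)
  obtain i k where i: "lab v = Leaf i k" using v by (cases "lab v") auto
  obtain w where w: "w \<in> V" "lab w = Core (\<not> i)" using core_nonempty[of "\<not> i"] by auto
  then have "w \<in> K" "w \<noteq> v" using K(2) i by (cases i; auto)+
  with K(1) v have "(v, w) \<in> parcs G" by (auto simp: is_clique_def)
  with i w show False by simp
qed

text \<open>The neighbours of a leaf lie in its core and its own clique, so they form a clique. The
  other vertices adjacent to all of core \<open>i\<close> lie in the opposite core; they are not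
  simplicial, because their own leaves are not adjacent to core \<open>i\<close>.\<close>

lemma adjacent_simplicial_core:
  assumes leaf: "\<And>i. leaves i \<noteq> {}"
  shows "adjacent_simplicial G (core i) = leaves i"
proof (intro equalityI subsetI)
  fix v assume v: "v \<in> adjacent_simplicial G (core i)"
  then have vV: "v \<in> V" and simp: "is_clique G (nbhd G v)" and sub: "core i \<subseteq> nbhd G v"
    by (auto simp: adjacent_simplicial_def simplicial_def)
  obtain a where a: "a \<in> V" "lab a = Core i" using core_nonempty[of i] by auto
  then have "a \<in> nbhd G v" using sub by blast
  then have av: "a \<noteq> v" "star_rel (lab v) (Core i)" using a(2) by (auto simp: nbhd_def)
  show "v \<in> leaves i"
  proof (cases "lab v")
    case (Core j)
    \<comment> \<open>A vertex of core \<open>i\<close> is not its own neighbour and so misses part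
      of that core.\<close>
    have "j \<noteq> i" using sub vV Core by (auto simp: nbhd_def)
    obtain b k where b: "b \<in> V" "lab b = Leaf j k" using leaf[of j] by auto
    have "a \<in> nbhd G v" "b \<in> nbhd G v" "a \<noteq> b" using a b vV Core av by (auto simp: nbhd_def)
    with simp have "(a, b) \<in> parcs G" by (auto simp: is_clique_def)
    with a b \<open>j \<noteq> i\<close> show ?thesis by simp
  qed (use av vV in auto)
next
  fix v assume "v \<in> leaves i"
  then obtain k where v: "v \<in> V" "lab v = Leaf i k" by auto
  have "star_rel (lab x) (lab y)" if "star_rel (Leaf i k) (lab x)" "star_rel (Leaf i k) (lab y)" for x y
    using that by (cases "(lab x, lab y)" rule: star_rel.cases) auto
  with v show "v \<in> adjacent_simplicial G (core i)"
    by (auto simp: adjacent_simplicial_def simplicial_def is_clique_def nbhd_def)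
qed

lemma SI_core_G:
  assumes "\<And>i. card (core i) = s" "\<And>i. card (leaves i) = p" "p > 0"
  shows "G \<in> SI_core s p"
proof -
  have leaf: "leaves i \<noteq> {}" for i using assms(2)[of i] assms(3) by (metis card.empty less_irrefl)
  have "core False \<noteq> core True" using core_nonempty[of False] by force
  then show ?thesis
    unfolding SI_core_def strictly_interval_def mem_Collect_eq
    using strictly_chordal_G interval_graph_G assms minimal_vertex_separators_G[OF leaf]
      maximal_clique_cores adjacent_simplicial_core[OF leaf]
    by (intro conjI exI[of _ "core False"] exI[of _ "core True"]) simp_all
qed

end

section \<open>The Laplacian spectrum of an expanded double star\<close>

text \<open>The eigenvalues due to one side with clique sizes \<open>ms\<close>: first those of
  contrasts between cliques, then those of contrasts inside a clique.\<close>

definition side_spectrum :: "nat \<Rightarrow> nat list \<Rightarrow> real multiset" where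
  "side_spectrum s ms = replicate_mset (length ms - 1) (real s) +
     (\<Sum>m\<leftarrow>ms. replicate_mset (m - 1) (real s + real m))"

text \<open>\<open>ms i\<close> lists the sizes of the cliques on side \<open>i\<close>; leaf labels
  beyond the end of the list have empty classes.\<close>

locale star_expansion = double_star V lab for V :: "'a::linorder set" and lab +
  fixes s p :: nat and ms :: "bool \<Rightarrow> nat list"
  assumes s_pos: "s > 0" and p_pos: "p > 0"
    and card_core: "card (core i) = s"
    and card_leaf: "card {v\<in>V. lab v = Leaf i k} = (if k < length (ms i) then ms i ! k else 0)"
    and ms_pos: "m \<in> set (ms i) \<Longrightarrow> m > 0"
    and sum_ms: "sum_list (ms i) = p"
begin

abbreviation leaf :: "bool \<Rightarrow> nat \<Rightarrow> 'a set" where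
  "leaf i k \<equiv> {v\<in>V. lab v = Leaf i k}"

lemma finite_classes [simp]: "finite (core i)" "finite (leaves i)" "finite (leaf i k)"
  using finite_V by auto

lemma leaf_index: "v \<in> V \<Longrightarrow> lab v = Leaf i k \<Longrightarrow> k < length (ms i)"
  using card_leaf[of i k] finite_V by (auto split: if_splits)

lemma leaf_nonempty: "k < length (ms i) \<Longrightarrow> leaf i k \<noteq> {}"
  using card_leaf[of i k] ms_pos[of "ms i ! k" i] by (metis card.empty less_irrefl nth_mem)

lemma leaves_eq: "leaves i = (\<Union>k<length (ms i). leaf i k)"
  using leaf_index by auto

lemma card_leaves: "card (leaves i) = p"
proof -
  have "card (leaves i) = (\<Sum>k<length (ms i). card (leaf i k))"
    unfolding leaves_eq by (rule card_UN_disjoint) auto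
  also have "\<dots> = (\<Sum>k<length (ms i). ms i ! k)" by (simp add: card_leaf)
  finally show ?thesis using sum_ms[of i] by (simp add: sum_list_sum_nth atLeast0LessThan)
qed

lemma length_ms: "length (ms i) > 0"
  using sum_ms[of i] p_pos by (cases "ms i") auto

lemma labels_eq: "lab ` V = range Core \<union> (\<Union>i. Leaf i ` {..<length (ms i)})"
proof (intro equalityI subsetI)
  fix a assume "a \<in> lab ` V"
  then obtain v where v: "v \<in> V" "a = lab v" by auto
  show "a \<in> range Core \<union> (\<Union>i. Leaf i ` {..<length (ms i)})"
  proof (cases a)
    case (Leaf i k)
    with v leaf_index[of v i k] have "k < length (ms i)" by simp
    with Leaf show ?thesis by blast
  qed simp
next
  fix a assume a: "a \<in> range Core \<union> (\<Union>i. Leaf i ` {..<length (ms i)})"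
  show "a \<in> lab ` V"
  proof (cases a)
    case (Core i)
    then show ?thesis using core_nonempty by simp
  next
    case (Leaf i k)
    with a have "k < length (ms i)" by auto
    then obtain v where "v \<in> V" "lab v = Leaf i k" using leaf_nonempty by blast
    then show ?thesis using Leaf by (intro image_eqI[of _ _ v]) simp_all
  qed
qed

lemma sum_labels:
  fixes g :: "label \<Rightarrow> 'b::comm_monoid_add"
  shows "(\<Sum>a\<in>lab ` V. g a) = (\<Sum>i\<in>UNIV. g (Core i) + (\<Sum>k<length (ms i). g (Leaf i k)))"
proof -
  have "(\<Sum>a\<in>lab ` V. g a) = (\<Sum>a\<in>range Core. g a) + (\<Sum>a\<in>(\<Union>i. Leaf i ` {..<length (ms i)}). g a)"
    unfolding labels_eq by (rule sum.union_disjoint) auto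
  also have "(\<Sum>a\<in>range Core. g a) = (\<Sum>i\<in>UNIV. g (Core i))"
    by (subst sum.reindex) (auto simp: inj_def)
  also have "(\<Sum>a\<in>(\<Union>i. Leaf i ` {..<length (ms i)}). g a) =
      (\<Sum>i\<in>UNIV. \<Sum>a\<in>Leaf i ` {..<length (ms i)}. g a)"
    by (rule sum.UNION_disjoint) auto
  also have "\<dots> = (\<Sum>i\<in>UNIV. \<Sum>k<length (ms i). g (Leaf i k))"
    by (intro sum.cong refl, subst sum.reindex) (auto simp: inj_on_def)
  finally show ?thesis by (simp only: sum.distrib)
qed

lemma card_labels: "card (lab ` V) = 2 + length (ms False) + length (ms True)"
  using sum_labels[of "\<lambda>_. 1 :: nat"] by (simp add: UNIV_bool)

lemma sum_core_nbhd:
  fixes g :: "'a \<Rightarrow> real"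
  shows "(\<Sum>u\<in>{u\<in>V. star_rel (Core i) (lab u)}. g u) =
    (\<Sum>u\<in>core i. g u) + (\<Sum>u\<in>core (\<not> i). g u) + (\<Sum>u\<in>leaves i. g u)"
proof -
  have "star_rel (Core i) a \<longleftrightarrow> a = Core i \<or> a = Core (\<not> i) \<or> (\<exists>k. a = Leaf i k)" for a
    by (cases a) auto
  then have "{u\<in>V. star_rel (Core i) (lab u)} = (core i \<union> core (\<not> i)) \<union> leaves i" by auto
  moreover have "(\<Sum>u\<in>(core i \<union> core (\<not> i)) \<union> leaves i. g u) =
      (\<Sum>u\<in>core i \<union> core (\<not> i). g u) + (\<Sum>u\<in>leaves i. g u)"
    by (rule sum.union_disjoint) auto
  moreover have "(\<Sum>u\<in>core i \<union> core (\<not> i). g u) = (\<Sum>u\<in>core i. g u) + (\<Sum>u\<in>core (\<not> i). g u)"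
    by (rule sum.union_disjoint) auto
  ultimately show ?thesis by simp
qed

lemma sum_leaf_nbhd:
  fixes g :: "'a \<Rightarrow> real"
  shows "(\<Sum>u\<in>{u\<in>V. star_rel (Leaf i k) (lab u)}. g u) =
    (\<Sum>u\<in>core i. g u) + (\<Sum>u\<in>leaf i k. g u)"
proof -
  have "star_rel (Leaf i k) a \<longleftrightarrow> a = Core i \<or> a = Leaf i k" for a
    by (cases a) auto
  then have "{u\<in>V. star_rel (Leaf i k) (lab u)} = core i \<union> leaf i k" by auto
  moreover have "(\<Sum>u\<in>core i \<union> leaf i k. g u) = (\<Sum>u\<in>core i. g u) + (\<Sum>u\<in>leaf i k. g u)"
    by (rule sum.union_disjoint) auto
  ultimately show ?thesis by simp
qed

lemma sum_V:
  fixes g :: "'a \<Rightarrow> real"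
  shows "(\<Sum>v\<in>V. g v) = (\<Sum>i\<in>UNIV. (\<Sum>v\<in>core i. g v) + (\<Sum>v\<in>leaves i. g v))"
proof -
  have "V = (\<Union>i. core i \<union> leaves i)" by (auto simp: UNIV_bool) (metis label.exhaust)
  then have "(\<Sum>v\<in>V. g v) = (\<Sum>v\<in>(\<Union>i. core i \<union> leaves i). g v)" by simp
  also have "\<dots> = (\<Sum>i\<in>UNIV. \<Sum>v\<in>core i \<union> leaves i. g v)"
    by (rule sum.UNION_disjoint) auto
  also have "\<dots> = (\<Sum>i\<in>UNIV. (\<Sum>v\<in>core i. g v) + (\<Sum>v\<in>leaves i. g v))"
    by (intro sum.cong refl sum.union_disjoint) auto
  finally show ?thesis .
qed

text \<open>These functions form a four-dimensional space that the Laplacian maps to itself,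
  whatever the clique sizes are.\<close>

definition side_fun :: "(bool \<Rightarrow> real) \<Rightarrow> (bool \<Rightarrow> real) \<Rightarrow> 'a \<Rightarrow> real" where
  "side_fun a b v = (case lab v of Core i \<Rightarrow> a i | Leaf i k \<Rightarrow> b i)"

text \<open>The parameter \<open>h\<close> covers both the values themselves and the differences
  occurring in the Laplacian.\<close>

lemma sum_side_fun:
  "(\<Sum>v\<in>core i. h (side_fun a b v)) = real s * h (a i)"
  "(\<Sum>v\<in>leaves i. h (side_fun a b v)) = real p * h (b i)"
  "(\<Sum>v\<in>leaf i k. h (side_fun a b v)) = real (card (leaf i k)) * h (b i)"
proof -
  have "(\<Sum>v\<in>core i. h (side_fun a b v)) = (\<Sum>v\<in>core i. h (a i))"
    by (rule sum.cong) (auto simp: side_fun_def)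
  then show "(\<Sum>v\<in>core i. h (side_fun a b v)) = real s * h (a i)" by (simp add: card_core)
  have "(\<Sum>v\<in>leaves i. h (side_fun a b v)) = (\<Sum>v\<in>leaves i. h (b i))"
    by (rule sum.cong) (auto simp: side_fun_def)
  then show "(\<Sum>v\<in>leaves i. h (side_fun a b v)) = real p * h (b i)" by (simp add: card_leaves)
  have "(\<Sum>v\<in>leaf i k. h (side_fun a b v)) = (\<Sum>v\<in>leaf i k. h (b i))"
    by (rule sum.cong) (auto simp: side_fun_def)
  then show "(\<Sum>v\<in>leaf i k. h (side_fun a b v)) = real (card (leaf i k)) * h (b i)" by simp
qed

text \<open>The eigenvalue equation needs checking only at a core and at a leaf of each side; at a
  leaf, the neighbours in its clique contribute zero.\<close>

lemma side_fun_eigenfunction: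
  assumes "v \<in> V"
    and core: "\<And>i. real s * (a i - a (\<not> i)) + real p * (a i - b i) = l * a i"
    and leaf: "\<And>i. real s * (b i - a i) = l * b i"
  shows "laplacian G (side_fun a b) v = l * side_fun a b v"
proof (cases "lab v")
  case (Core i)
  then have "side_fun a b v = a i" by (simp add: side_fun_def)
  then show ?thesis
    using assms(1) core[of i] Core finite_V reflp_star_rel
    by (simp add: laplacian_twin_expansion sum_core_nbhd sum_side_fun[where h = "\<lambda>x. a i - x"])
next
  case (Leaf i k)
  then have "side_fun a b v = b i" by (simp add: side_fun_def)
  then show ?thesis
    using assms(1) leaf[of i] Leaf finite_V reflp_star_rel
    by (simp add: laplacian_twin_expansion sum_leaf_nbhd sum_side_fun[where h = "\<lambda>x. b i - x"])
qed

lemma side_fun_inner: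
  "(\<Sum>v\<in>V. side_fun a b v * side_fun a' b' v) =
    (\<Sum>i\<in>UNIV. real s * (a i * a' i) + real p * (b i * b' i))"
proof -
  have "side_fun a b v * side_fun a' b' v = side_fun (\<lambda>i. a i * a' i) (\<lambda>i. b i * b' i) v" for v
    by (simp add: side_fun_def split: label.splits)
  then show ?thesis
    using sum_side_fun[where h = "\<lambda>x. x"] by (simp add: sum_V)
qed

lemma side_fun_nonzero: "b i \<noteq> 0 \<Longrightarrow> \<exists>v\<in>V. side_fun a b v \<noteq> 0"
  using leaf_nonempty[OF length_ms[of i]] by (auto simp: side_fun_def intro!: bexI)

lemma side_fun_const: "const_on {v\<in>V. lab v = a} (side_fun b c)" "const_on (leaves i) (side_fun b c)"
  by (auto simp: const_on_def side_fun_def)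

text \<open>At a leaf the clique contributes nothing, as \<open>f\<close> is constant there, and the
  \<open>s\<close> core vertices contribute \<open>f v\<close> each. At a core vertex everything
  cancels, since \<open>f\<close> vanishes on the cores and has sum zero over the leaves of each
  side.\<close>

lemma leaf_contrast_eigenfunction:
  assumes v: "v \<in> V" and f: "contrast_on V (leaves i) f"
    and const: "\<And>k. k < length (ms i) \<Longrightarrow> const_on (leaf i k) f"
  shows "laplacian G f v = real s * f v"
proof -
  have zero: "f u = 0" if "u \<notin> leaves i" for u using f that by (simp only: contrast_on_def) blast
  have core0: "(\<Sum>u\<in>core j. f u) = 0" for j by (rule sum.neutral) (auto intro!: zero)
  have "(\<Sum>u\<in>leaves i. f u) = (\<Sum>u\<in>V. f u)"
    using finite_V zero by (intro sum.mono_neutral_left) auto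
  then have leaves_i: "(\<Sum>u\<in>leaves i. f u) = 0" using f by (simp add: contrast_on_def)
  have leaves0: "(\<Sum>u\<in>leaves j. f u) = 0" for j
  proof (cases "j = i")
    case False
    then show ?thesis by (intro sum.neutral) (auto intro!: zero)
  qed (simp add: leaves_i)
  show ?thesis
  proof (cases "lab v")
    case (Core j)
    then have "f v = 0" by (intro zero) auto
    then show ?thesis
      using v Core finite_V reflp_star_rel
      by (simp add: laplacian_twin_expansion sum_core_nbhd sum_negf core0 leaves0)
  next
    case (Leaf j k)
    have "f u = f v" if "u \<in> leaf j k" for u
    proof (cases "j = i")
      case True
      with const leaf_index[OF v Leaf] have "const_on (leaf j k) f" by simp
      then show ?thesis using that v Leaf unfolding const_on_def by blast
    next
      case False
      then have "f u = 0" "f v = 0" using that Leaf by (auto intro!: zero)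
      then show ?thesis by simp
    qed
    then have "(\<Sum>u\<in>leaf j k. f v - f u) = 0" by (intro sum.neutral) auto
    moreover have "(\<Sum>u\<in>core j. f v - f u) = real s * f v"
      by (simp add: sum_subtractf core0 card_core)
    ultimately show ?thesis
      using v Leaf finite_V reflp_star_rel
      by (simp add: laplacian_twin_expansion sum_leaf_nbhd)
  qed
qed

text \<open>There is one class-constant eigenfunction per label: \<open>length (ms i) - 1\<close>
  contrasts between the cliques of each side and four functions of the form \<open>side_fun\<close>.
  The contrasts within classes come from \<open>spectrum_twin_expansion\<close>.\<close>

lemma laplacian_spectrum_G:
  assumes sum_c: "c + c' = 3 * real s + real p" and prod_c: "c * c' = 2 * (real s)\<^sup>2"
  shows "laplacian_spectrum G = {#c, c', real s + real p, 0#} +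
    replicate_mset (2 * (s - 1)) (2 * real s + real p) +
    side_spectrum s (ms False) + side_spectrum s (ms True)"
proof -
  have "\<exists>fs. length fs = length (ms i) - 1 \<and> orthogonal_list V fs \<and>
      (\<forall>f\<in>set fs. contrast_on V (leaves i) f \<and> (\<forall>k<length (ms i). const_on (leaf i k) f))" for i
  proof -
    let ?As = "map (leaf i) [0..<length (ms i)]"
    have "\<forall>A\<in>set ?As. A \<subseteq> V \<and> A \<noteq> {}" using leaf_nonempty by auto
    moreover have "sorted_wrt disjnt ?As" by (auto simp: sorted_wrt_iff_nth_less disjnt_def)
    ultimately obtain fs where fs: "length fs = length ?As - 1 \<and> orthogonal_list V fs \<and>
        (\<forall>f\<in>set fs. contrast_on V (\<Union>(set ?As)) f \<and> (\<forall>A\<in>set ?As. const_on A f))"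
      using helmert_contrasts[OF finite_V, of ?As] by presburger
    have "\<Union>(set ?As) = leaves i" unfolding leaves_eq by auto
    moreover have "leaf i k \<in> set ?As" if "k < length (ms i)" for k using that by auto
    ultimately show ?thesis using fs by (intro exI[of _ fs]) (simp del: set_map set_upt)
  qed
  then have "\<exists>H. \<forall>i. length (H i) = length (ms i) - 1 \<and> orthogonal_list V (H i) \<and>
      (\<forall>f\<in>set (H i). contrast_on V (leaves i) f \<and> (\<forall>k<length (ms i). const_on (leaf i k) f))"
    by (intro choice allI)
  then obtain H where len_H: "\<And>i. length (H i) = length (ms i) - 1"
    and orth_H: "\<And>i. orthogonal_list V (H i)"
    and H: "\<And>i f. f \<in> set (H i) \<Longrightarrow> contrast_on V (leaves i) f"
    and const_H: "\<And>i f k. f \<in> set (H i) \<Longrightarrow> k < length (ms i) \<Longrightarrow> const_on (leaf i k) f"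
    by blast
  define sg :: "bool \<Rightarrow> real" where "sg i = (if i then 1 else - 1)" for i
  have sg: "sg (\<not> i) = - sg i" for i by (simp add: sg_def)
  \<comment> \<open>The leaf equation \<open>s (b - a) = c b\<close> is solved by
    \<open>b = s\<close>, \<open>a = s - c\<close>; the core equation then becomes the quadratic
    with roots \<open>c\<close> and \<open>c'\<close>. The sign \<open>sg\<close> makes the function
    antisymmetric.\<close>
  define F where "F c = side_fun (\<lambda>i. sg i * (real s - c)) (\<lambda>i. sg i * real s)" for c
  \<comment> \<open>The symmetric function with weights chosen orthogonal to the constants.\<close>
  define F2 where "F2 = side_fun (\<lambda>_. real p) (\<lambda>_. - real s)"
  define F0 where "F0 = side_fun (\<lambda>_. 1) (\<lambda>_. 1)"
  define ts where "ts = [(c, F c), (c', F c'), (real s + real p, F2), (0, F0)]"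
  define hs where "hs = map (Pair (real s)) (H False) @ map (Pair (real s)) (H True) @ ts"
  have eig_F: "laplacian G (F x) v = x * F x v"
    if "v \<in> V" "x * x = (3 * real s + real p) * x - 2 * (real s)\<^sup>2" for v x
    unfolding F_def
  proof (rule side_fun_eigenfunction[OF that(1)])
    fix i
    have "2 * real s * (real s - x) - real p * x = x * (real s - x)"
      using that(2) by (simp add: algebra_simps power2_eq_square)
    then have "sg i * (2 * real s * (real s - x) - real p * x) = sg i * (x * (real s - x))" by simp
    then show "real s * (sg i * (real s - x) - sg (\<not> i) * (real s - x)) +
        real p * (sg i * (real s - x) - sg i * real s) = x * (sg i * (real s - x))"
      by (simp add: sg algebra_simps)
    show "real s * (sg i * real s - sg i * (real s - x)) = x * (sg i * real s)"
      by (simp add: algebra_simps)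
  qed
  have root: "c * c = (3 * real s + real p) * c - 2 * (real s)\<^sup>2"
    "c' * c' = (3 * real s + real p) * c' - 2 * (real s)\<^sup>2"
    unfolding prod_c[symmetric] sum_c[symmetric] by (simp_all add: algebra_simps)
  have eig_ts: "laplacian G f v = l * f v" if "(l, f) \<in> set ts" "v \<in> V" for l f v
  proof -
    have "laplacian G F2 v = (real s + real p) * F2 v"
      unfolding F2_def by (rule side_fun_eigenfunction[OF that(2)]) (simp_all add: algebra_simps)
    moreover have "laplacian G F0 v = 0 * F0 v"
      unfolding F0_def by (rule side_fun_eigenfunction[OF that(2)]) simp_all
    ultimately show ?thesis using that(1) eig_F[OF that(2)] root by (auto simp: ts_def)
  qed
  \<comment> \<open>Half the inner product of \<open>F c\<close> and \<open>F c'\<close>; it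
    vanishes by the given sum and product of the roots.\<close>
  have "real s * ((real s - c) * (real s - c')) + real p * (real s * real s) =
      real s * (real s * real s - real s * (c + c') + c * c' + real p * real s)"
    by (simp add: algebra_simps)
  also have "\<dots> = 0" unfolding sum_c prod_c by (simp add: algebra_simps power2_eq_square)
  finally have FF: "(\<Sum>v\<in>V. F c v * F c' v) = 0"
    by (simp add: F_def side_fun_inner UNIV_bool sg_def algebra_simps)
  have FF2: "(\<Sum>v\<in>V. F x v * F2 v) = 0" and FF0: "(\<Sum>v\<in>V. F x v * F0 v) = 0" for x
    by (simp_all add: F_def F2_def F0_def side_fun_inner UNIV_bool sg_def algebra_simps)
  have F2F0: "(\<Sum>v\<in>V. F2 v * F0 v) = 0"
    by (simp add: F2_def F0_def side_fun_inner UNIV_bool)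
  have "\<exists>v\<in>V. F x v \<noteq> 0" "\<exists>v\<in>V. F2 v \<noteq> 0" "\<exists>v\<in>V. F0 v \<noteq> 0" for x
    unfolding F_def F2_def F0_def using s_pos by (intro side_fun_nonzero[of _ True]; simp add: sg_def)+
  with FF FF2 FF0 F2F0 have orth_ts: "orthogonal_list V (map snd ts)"
    by (simp add: ts_def orthogonal_list_def)
  have side_ts: "\<exists>a b. f = side_fun a b" if "(l, f) \<in> set ts" for l f
    using that by (auto simp: ts_def F_def F2_def F0_def)
  have H_ts: "(\<Sum>v\<in>V. f v * g v) = 0" if f: "f \<in> set (H i)" and g: "(l, g) \<in> set ts" for i l f g
  proof -
    obtain a b where "g = side_fun a b" using side_ts[OF g] by blast
    then have "const_on (leaves i) g" by (simp only: side_fun_const(2))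
    then show ?thesis by (rule contrast_const_orthogonal[OF H[OF f]])
  qed
  have H_H: "(\<Sum>v\<in>V. f v * g v) = 0" if "f \<in> set (H False)" "g \<in> set (H True)" for f g
  proof (rule contrast_const_orthogonal[OF H[OF that(1)]])
    have "g v = 0" if "v \<in> leaves False" for v
      using H[OF \<open>g \<in> set (H True)\<close>] that by (auto simp: contrast_on_def)
    then show "const_on (leaves False) g" by (simp add: const_on_def)
  qed
  \<comment> \<open>The value attached to a label is the size of the closed neighbourhood of its
    vertices.\<close>
  have "laplacian_spectrum G = mset (map fst hs) + (\<Sum>a\<in>lab ` V. replicate_mset (card {v\<in>V. lab v = a} - 1)
      (case a of Core i \<Rightarrow> 2 * real s + real p | Leaf i k \<Rightarrow> real s + real (ms i ! k)))"
  proof (rule spectrum_twin_expansion[OF finite_V reflp_star_rel symp_star_rel])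
    show "length hs = card (lab ` V)"
      using length_ms[of True] length_ms[of False] by (simp add: hs_def ts_def card_labels len_H)
    show "laplacian G f v = l * f v" if "(l, f) \<in> set hs" "v \<in> V" for l f v
      using that eig_ts leaf_contrast_eigenfunction[OF that(2) H const_H] by (auto simp: hs_def)
    show "orthogonal_list V (map snd hs)"
      using orth_H orth_ts H_ts H_H by (auto simp: hs_def orthogonal_list_append comp_def)
    show "const_on {v\<in>V. lab v = a} f" if "(l, f) \<in> set hs" for l f a
    proof (cases "(l, f) \<in> set ts")
      case True
      then obtain b c where "f = side_fun b c" using side_ts by blast
      then show ?thesis by (simp only: side_fun_const(1))
    next
      case False
      with that obtain i where f: "f \<in> set (H i)" by (auto simp: hs_def)
      show ?thesis
      proof (cases "\<exists>k<length (ms i). a = Leaf i k")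
        case True
        then show ?thesis using const_H[OF f] by auto
      next
        case False
        then have "v \<notin> leaves i" if "v \<in> V" "lab v = a" for v
          using that leaf_index[of v i] by blast
        then have "f v = 0" if "v \<in> V" "lab v = a" for v
          using H[OF f] that unfolding contrast_on_def by blast
        then show ?thesis by (simp add: const_on_def)
      qed
    qed
    show "real (card {u\<in>V. star_rel (lab v) (lab u)}) =
        (case lab v of Core i \<Rightarrow> 2 * real s + real p | Leaf i k \<Rightarrow> real s + real (ms i ! k))"
      if "v \<in> V" for v
      using sum_core_nbhd[where g = "\<lambda>_. 1"] sum_leaf_nbhd[where g = "\<lambda>_. 1"] leaf_index[OF that]
      by (cases "lab v") (simp_all add: card_core card_leaves card_leaf)
  qed
  also have "(\<Sum>a\<in>lab ` V. replicate_mset (card {v\<in>V. lab v = a} - 1)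
      (case a of Core i \<Rightarrow> 2 * real s + real p | Leaf i k \<Rightarrow> real s + real (ms i ! k))) =
      (\<Sum>i\<in>UNIV. replicate_mset (s - 1) (2 * real s + real p) +
        (\<Sum>m\<leftarrow>ms i. replicate_mset (m - 1) (real s + real m)))"
    unfolding sum_labels by (simp add: card_core card_leaf sum_list_sum_nth atLeast0LessThan)
  also have "mset (map fst hs) = {#c, c', real s + real p, 0#} +
      replicate_mset (length (ms False) - 1) (real s) + replicate_mset (length (ms True) - 1) (real s)"
    by (simp add: hs_def ts_def comp_def map_replicate_const len_H)
  moreover have "replicate_mset (2 * (s - 1)) (2 * real s + real p) =
      replicate_mset (s - 1) (2 * real s + real p) + replicate_mset (s - 1) (2 * real s + real p)"
    by (simp add: multiset_eq_iff)
  ultimately show ?thesis by (simp add: side_spectrum_def UNIV_bool)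
qed

end

section \<open>Realizing prescribed class sizes\<close>

text \<open>The disjoint union of blocks of sizes \<open>N a\<close> is enumerated by an initial
  segment of the naturals, and each number is labelled by its block.\<close>

lemma ex_labelling:
  fixes N :: "'b \<Rightarrow> nat"
  assumes "finite {a. N a > 0}"
  shows "\<exists>(V :: nat set) lab. finite V \<and> (\<forall>a. card {v\<in>V. lab v = a} = N a)"
proof -
  let ?S = "SIGMA a:{a. N a > 0}. {..<N a}"
  have "finite ?S" using assms by auto
  then obtain h where h: "bij_betw h {0..<card ?S} ?S" using ex_bij_betw_nat_finite by blast
  have "card {v\<in>{0..<card ?S}. (fst \<circ> h) v = a} = N a" for a
  proof -
    have "h ` {v\<in>{0..<card ?S}. (fst \<circ> h) v = a} = {x\<in>h ` {0..<card ?S}. fst x = a}" by auto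
    also have "h ` {0..<card ?S} = ?S" using h by (rule bij_betw_imp_surj_on)
    finally have "h ` {v\<in>{0..<card ?S}. (fst \<circ> h) v = a} = {x\<in>?S. fst x = a}" .
    moreover have "inj_on h {v\<in>{0..<card ?S}. (fst \<circ> h) v = a}"
      by (rule inj_on_subset[OF bij_betw_imp_inj_on[OF h]]) blast
    then have "card {v\<in>{0..<card ?S}. (fst \<circ> h) v = a} =
        card (h ` {v\<in>{0..<card ?S}. (fst \<circ> h) v = a})"
      by (rule card_image[symmetric])
    ultimately have "card {v\<in>{0..<card ?S}. (fst \<circ> h) v = a} = card {x\<in>?S. fst x = a}"
      by (simp only:)
    also have "{x\<in>?S. fst x = a} = {a} \<times> {..<N a}" by auto
    finally show ?thesis by (simp add: card_cartesian_product)
  qed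
  then show ?thesis by (intro exI[of _ "{0..<card ?S}"] exI[of _ "fst \<circ> h"]) simp
qed

lemma ex_star_expansion:
  assumes "s > 0" "p > 0" "\<And>i m. m \<in> set (ms i) \<Longrightarrow> m > 0" "\<And>i. sum_list (ms i) = p"
  shows "\<exists>(V :: nat set) lab. star_expansion V lab s p ms"
proof -
  define N where "N a = (case a of Core i \<Rightarrow> s | Leaf i k \<Rightarrow> if k < length (ms i) then ms i ! k else 0)" for a
  have "{a. N a > 0} \<subseteq> range Core \<union> (\<Union>i. Leaf i ` {..<length (ms i)})"
  proof
    fix a assume "a \<in> {a. N a > 0}"
    then show "a \<in> range Core \<union> (\<Union>i. Leaf i ` {..<length (ms i)})"
      by (cases a) (auto simp: N_def split: if_splits)
  qed
  then have "finite {a. N a > 0}" by (rule finite_subset) auto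
  then obtain V :: "nat set" and lab where V: "finite V" "\<And>a. card {v\<in>V. lab v = a} = N a"
    using ex_labelling by blast
  have "Core i \<in> lab ` V" for i
  proof -
    have "card {v\<in>V. lab v = Core i} = s" using V(2)[of "Core i"] by (simp add: N_def)
    then have "{v\<in>V. lab v = Core i} \<noteq> {}" using assms(1) by (metis card.empty less_irrefl)
    then show ?thesis by force
  qed
  then have "star_expansion V lab s p ms"
    by unfold_locales (use V assms in \<open>auto simp: N_def\<close>)
  then show ?thesis by blast
qed

section \<open>From the spectral data to clique sizes\<close>

text \<open>A value \<open>x > s\<close> with parameter \<open>k x\<close> is realized by
  \<open>k x\<close> cliques of size \<open>x - s\<close>, an integer by assumption; they produce
  \<open>k x * (x - s - 1)\<close> copies of \<open>x\<close>, exactly its multiplicity. The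
  multiplicity of \<open>s\<close> is then forced by the size of \<open>X\<close>.\<close>

lemma spectral_part_side_spectrum:
  assumes "spectral_part s p X" "set_mset X \<subseteq> \<int>" "p > 0"
  shows "\<exists>ms. (\<forall>m\<in>set ms. m > 0) \<and> sum_list ms = p \<and> X = side_spectrum s ms"
proof -
  obtain k :: "real \<Rightarrow> nat" where size_X: "size X = p - 1"
    and ge: "\<And>x. x \<in># X \<Longrightarrow> real s \<le> x"
    and k: "\<And>x. x \<in># X \<Longrightarrow> x > real s \<Longrightarrow> x \<ge> real s + 2 \<and>
      real (count X x) = real (k x) * (x - real s - 1)"
    and le: "(\<Sum>x\<in>set_mset X. if x = real s then 0 else real (k x) * (x - real s)) \<le> real p"
    using assms(1) unfolding spectral_part_def by blast
  define T where "T = set_mset X - {real s}"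
  define \<nu> where "\<nu> x = nat \<lfloor>x - real s\<rfloor>" for x
  have \<nu>: "real (\<nu> x) = x - real s" "\<nu> x \<ge> 2" "count X x = k x * (\<nu> x - 1)" if "x \<in> T" for x
  proof -
    have x: "x \<in># X" "x > real s" using that ge[of x] by (auto simp: T_def)
    have "x - real s \<in> \<int>" using x(1) assms(2) by auto
    then obtain z where z: "x - real s = of_int z" by (rule Ints_cases)
    with x(2) show 1: "real (\<nu> x) = x - real s" by (simp add: \<nu>_def)
    show 2: "\<nu> x \<ge> 2" using 1 k[OF x] by linarith
    have "real (count X x) = real (k x * (\<nu> x - 1))"
      using k[OF x] 1 2 by (simp add: of_nat_diff)
    then show "count X x = k x * (\<nu> x - 1)" by (simp only: of_nat_eq_iff)
  qed
  define N where "N = (\<Sum>x\<in>T. k x * \<nu> x)"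
  have "(\<Sum>x\<in>set_mset X. if x = real s then 0 else real (k x) * (x - real s)) = real N"
    unfolding N_def of_nat_sum
    by (rule sum.mono_neutral_cong_right) (auto simp: T_def \<nu>)
  then have N: "N \<le> p" using le by simp
  \<comment> \<open>The cliques read off from \<open>X\<close>, filled up to \<open>p\<close>
    vertices by cliques of size 1, which contribute nothing to \<open>W\<close> below.\<close>
  define M where "M = (\<Sum>x\<in>T. replicate_mset (k x) (\<nu> x)) + replicate_mset (p - N) 1"
  obtain ms where ms: "mset ms = M" using ex_mset by blast
  have fin: "finite T" by (simp add: T_def)
  have pos: "\<forall>m\<in>set ms. m > 0"
  proof
    fix m assume "m \<in> set ms"
    then have "m \<in># M" by (simp flip: ms)
    then have "m = 1 \<or> (\<exists>x\<in>T. m = \<nu> x)"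
      using fin by (auto simp: M_def set_mset_sum split: if_splits)
    then show "m > 0" using \<nu>(2) by fastforce
  qed
  have "sum_mset (\<Sum>x\<in>U. replicate_mset (k x) (\<nu> x)) = (\<Sum>x\<in>U. k x * \<nu> x)" if "finite U" for U
    using that by induction auto
  from this[OF fin] have "sum_mset M = p" using N by (simp add: M_def N_def[symmetric])
  then have sum: "sum_list ms = p" using ms by (metis sum_mset_sum_list)
  define W where "W = (\<Sum>m\<leftarrow>ms. replicate_mset (m - 1) (real s + real m))"
  have rep: "\<Sum>\<^sub># (replicate_mset j A) = repeat_mset j A" for j and A :: "real multiset"
    by (induction j) auto
  have "W = (\<Sum>m\<in>#M. replicate_mset (m - 1) (real s + real m))"
    by (simp add: W_def flip: ms sum_mset_sum_list)
  also have "\<dots> = (\<Sum>x\<in>T. repeat_mset (k x) (replicate_mset (\<nu> x - 1) (real s + real (\<nu> x))))"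
  proof -
    have "(\<Sum>m\<in>#(\<Sum>x\<in>U. replicate_mset (k x) (\<nu> x)). replicate_mset (m - 1) (real s + real m)) =
      (\<Sum>x\<in>U. repeat_mset (k x) (replicate_mset (\<nu> x - 1) (real s + real (\<nu> x))))" if "finite U" for U
      using that by induction (auto simp: rep)
    from this[OF fin] show ?thesis by (simp add: M_def rep)
  qed
  also have "\<dots> = (\<Sum>x\<in>T. replicate_mset (count X x) x)"
    by (rule sum.cong) (auto simp: \<nu> multiset_eq_iff)
  finally have W: "W = (\<Sum>x\<in>T. replicate_mset (count X x) x)" .
  have X: "X = W + replicate_mset (count X (real s)) (real s)"
  proof (rule multiset_eqI)
    fix y
    have "count W y = (\<Sum>x\<in>T. if x = y then count X y else 0)"
      unfolding W count_sum by (rule sum.cong) auto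
    then show "count X y = count (W + replicate_mset (count X (real s)) (real s)) y"
      using fin by (auto simp: T_def not_in_iff)
  qed
  \<comment> \<open>A clique of size \<open>m\<close> gives \<open>m - 1\<close> elements of
    \<open>W\<close>, so one is missing per clique. Comparison with \<open>size X = p - 1\<close>
    yields the multiplicity of \<open>s\<close>.\<close>
  have "size W + length ms = p"
  proof -
    have "size (\<Sum>m\<leftarrow>ms. replicate_mset (m - 1) (real s + real m)) + length ms = sum_list ms"
      using pos by (induction ms) auto
    then show ?thesis by (simp add: W_def sum)
  qed
  moreover have "size W + count X (real s) = p - 1"
    using size_X arg_cong[OF X, of size] by simp
  ultimately have "count X (real s) = length ms - 1" using assms(3) by linarith
  with X have "X = side_spectrum s ms" by (simp add: side_spectrum_def W_def add.commute)
  with pos sum show ?thesis by blast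
qed

theorem theorem11:
  fixes s p n :: nat
    and X Y Z :: "real multiset"
    and c1 c2 c3 c4 d1 :: real
  assumes "s \<ge> 2" and "p \<ge> 2" and "n = 2 * s + 2 * p"
    and "c1 = (3 * real s + real p + sqrt ((real s + real p)^2 + 4 * real s * real p)) / 2"
    and "d1 = 2 * real s + real p"
    and "c2 = real s + real p"
    and "c3 = (3 * real s + real p - sqrt ((real s + real p)^2 + 4 * real s * real p)) / 2"
    and "c4 = 0"
    and "spectral_part s p X" and "set_mset X \<subseteq> \<int>"
    and "spectral_part s p Y" and "set_mset Y \<subseteq> \<int>"
    and "size Z = n"
    and "Z = {#c1#} + replicate_mset (2 * (s - 1)) d1 + {#c2, c3, c4#} + X + Y"
  shows "\<exists>G :: nat pair_pre_digraph. G \<in> SI_core s p \<and> laplacian_spectrum G = Z"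
proof -
  have pos: "s > 0" "p > 0" using assms(1,2) by auto
  obtain msX where X: "\<forall>m\<in>set msX. m > 0" "sum_list msX = p" "X = side_spectrum s msX"
    using spectral_part_side_spectrum[OF assms(9,10) pos(2)] by blast
  obtain msY where Y: "\<forall>m\<in>set msY. m > 0" "sum_list msY = p" "Y = side_spectrum s msY"
    using spectral_part_side_spectrum[OF assms(11,12) pos(2)] by blast
  define ms where "ms i = (if i then msY else msX)" for i
  have ms: "m > 0" if "m \<in> set (ms i)" for i m
    using that X(1) Y(1) by (auto simp: ms_def split: if_splits)
  have "sum_list (ms i) = p" for i using X(2) Y(2) by (simp add: ms_def)
  then obtain V :: "nat set" and lab where "star_expansion V lab s p ms"
    using ex_star_expansion[of s p ms] pos ms by blast
  then interpret star_expansion V lab s p ms .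
  \<comment> \<open>With \<open>d\<close> the square root, \<open>c1 * c3\<close> is a quarter of
    \<open>(3s + p)^2 - d^2 = 8 s^2\<close>.\<close>
  define d where "d = sqrt ((real s + real p)^2 + 4 * real s * real p)"
  have "d * d = (real s + real p)^2 + 4 * real s * real p" by (simp add: d_def)
  then have "c1 * c3 = 2 * (real s)\<^sup>2"
    unfolding assms(4,7) d_def[symmetric] by (simp add: field_simps power2_eq_square)
  moreover have "c1 + c3 = 3 * real s + real p" unfolding assms(4,7) by (simp add: field_simps)
  ultimately have "laplacian_spectrum G = Z"
    using X(3) Y(3) assms(5,6,8,14) by (simp add: laplacian_spectrum_G ms_def)
  moreover have "G \<in> SI_core s p" by (rule SI_core_G[OF card_core card_leaves pos(2)])
  ultimately show ?thesis by blast
qed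

end
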